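(* Let $n\ge 3$, and for $\mathbf J=(J_1,\dots,J_n)$ with all $J_i>0$ let $\tau^*(\mathbf J)=\tau_2(\mathbf J)-1$, where $\tau_2(\mathbf J)$ is the relaxation time of the heat-bath Glauber dynamics for the ferromagnetic Ising model on the $n$-cycle with couplings $\mathbf J$. Then for all such $\mathbf J$ and all $t\ge 0$, $$\tau^*\Big(\tfrac12\sinh^{-1}\big(\exp(2t)\sinh(2\mathbf J)\big)\Big)\ \ge\ \exp(2t)\,\tau^*(\mathbf J),$$ where $\sinh^{-1}$ is the inverse hyperbolic sine and functions are applied to $\mathbf J$ entrywise, i.e. the argument on the left is the vector whose $i$-th entry is $\tfrac12\sinh^{-1}\big(\exp(2t)\sinh(2J_i)\big)$.
   Context: The cycle has vertices $\{1,\dots,n\}$ and edges $[1,2],[2,3],\dots,[n,1]$; indices are taken mod $n$, so $n+1\equiv 1$. The edge $[i,i+1]$ has coupling $J_i>0$. A configuration is $\sigma\in\{+1,-1\}^n$, and the Gibbs measure (no external field, no boundary conditions) is $\pi(\sigma)=Z^{-1}\exp\big(\sum_{i=1}^n J_i\sigma_i\sigma_{i+1}\big)$, where $Z$ is the normalizing constant. For a vertex $i$, let $\sigma^i$ be the configuration obtained from $\sigma$ by flipping the spin at $i$. The heat-bath Glauber dynamics is the Markov chain on $\{+1,-1\}^n$ with transition matrix $A$ of size $2^n\times 2^n$ given by $A(\sigma,\sigma^i)=\frac1n\,\frac{\pi(\sigma^i)}{\pi(\sigma)+\pi(\sigma^i)}$ for each $i$, $A(\sigma,\sigma)=1-\sum_{i}A(\sigma,\sigma^i)$,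 and $A(\sigma,\tau)=0$ for all other $\tau$. It is reversible with respect to $\pi$, so its eigenvalues are real; they are listed with multiplicity as $1=\mu_1>\mu_2\ge\dots\ge\mu_{2^n}$. The relaxation time is $\tau_2=\big(n(1-\mu_2)\big)^{-1}$. *)

theory Defs
  imports
    Complex_Main
    "HOL-Library.FuncSet"
    "HOL-Library.Multiset"
    "HOL-Computational_Algebra.Polynomial"
    "Jordan_Normal_Form.Char_Poly"
begin

(* A configuration is a function that is +1 or -1 on the vertices 1..n and undefined elsewhere,
   so that this set has exactly 2^n elements. *)
definition configs :: "nat \<Rightarrow> (nat \<Rightarrow> real) set" where
  "configs n = {1..n} \<rightarrow>\<^sub>E {1, -1}"

definition cyc_succ :: "nat \<Rightarrow> nat \<Rightarrow> nat" where
  "cyc_succ n i = (if i = n then 1 else i + 1)"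

definition flip_spin :: "nat \<Rightarrow> (nat \<Rightarrow> real) \<Rightarrow> (nat \<Rightarrow> real)" where
  "flip_spin i \<sigma> = \<sigma>(i := - \<sigma> i)"

definition boltzmann_weight :: "nat \<Rightarrow> (nat \<Rightarrow> real) \<Rightarrow> (nat \<Rightarrow> real) \<Rightarrow> real" where
  "boltzmann_weight n J \<sigma> = exp (\<Sum>i=1..n. J i * \<sigma> i * \<sigma> (cyc_succ n i))"

definition partition_function :: "nat \<Rightarrow> (nat \<Rightarrow> real) \<Rightarrow> real" where
  "partition_function n J = (\<Sum>\<sigma>\<in>configs n. boltzmann_weight n J \<sigma>)"

definition gibbs :: "nat \<Rightarrow> (nat \<Rightarrow> real) \<Rightarrow> (nat \<Rightarrow> real) \<Rightarrow> real" where
  "gibbs n J \<sigma> = boltzmann_weight n J \<sigma> / partition_function n J"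

definition flip_prob :: "nat \<Rightarrow> (nat \<Rightarrow> real) \<Rightarrow> (nat \<Rightarrow> real) \<Rightarrow> nat \<Rightarrow> real" where
  "flip_prob n J \<sigma> i =
     (1 / real n) * (gibbs n J (flip_spin i \<sigma>) / (gibbs n J \<sigma> + gibbs n J (flip_spin i \<sigma>)))"

(* A configuration tau different from sigma is flip_spin i sigma for at most one i,
   so at most one summand of the second sum is nonzero. *)
definition glauber :: "nat \<Rightarrow> (nat \<Rightarrow> real) \<Rightarrow> (nat \<Rightarrow> real) \<Rightarrow> (nat \<Rightarrow> real) \<Rightarrow> real" where
  "glauber n J \<sigma> \<tau> =
     (if \<tau> = \<sigma> then 1 - (\<Sum>i=1..n. flip_prob n J \<sigma> i)
      else (\<Sum>i=1..n. if \<tau> = flip_spin i \<sigma> then flip_prob n J \<sigma> i else 0))"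

(* Library matrices are indexed by natural numbers below the dimension, so the configurations are
   enumerated by binary expansion; the characteristic polynomial does not depend on the
   enumeration. *)
definition nth_config :: "nat \<Rightarrow> nat \<Rightarrow> (nat \<Rightarrow> real)" where
  "nth_config n k = (\<lambda>i\<in>{1..n}. if bit k (i - 1) then 1 else -1)"

lemma bij_betw_nth_config: "bij_betw (nth_config n) {..<2 ^ n} (configs n)"
proof -
  have inj: "inj_on (nth_config n) {..<2 ^ n}"
  proof (rule inj_onI)
    fix k l :: nat
    assume k: "k \<in> {..<2 ^ n}" and l: "l \<in> {..<2 ^ n}" and eq: "nth_config n k = nth_config n l"
    have "bit k j = bit l j" if "j < n" for j
    proof -
      have "nth_config n k (Suc j) = nth_config n l (Suc j)"
        using eq by simp
      then show ?thesis
        using that by (simp add: nth_config_def split: if_splits)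
    qed
    then have "take_bit n k = take_bit n l"
      by (auto simp: bit_eq_iff bit_take_bit_iff)
    then show "k = l"
      using k l by (simp add: take_bit_nat_eq_self_iff[THEN iffD2])
  qed
  have sub: "nth_config n ` {..<2 ^ n} \<subseteq> configs n"
    by (auto simp: nth_config_def configs_def)
  have fin: "finite (configs n)"
    unfolding configs_def by (rule finite_PiE) auto
  have "card (configs n) = 2 ^ n"
    by (simp add: configs_def card_PiE numeral_2_eq_2)
  then have "nth_config n ` {..<2 ^ n} = configs n"
    using card_subset_eq[OF fin sub] card_image[OF inj] by simp
  with inj show ?thesis
    by (simp add: bij_betw_def)
qed

definition glauber_matrix :: "nat \<Rightarrow> (nat \<Rightarrow> real) \<Rightarrow> real mat" where
  "glauber_matrix n J =
     mat (2 ^ n) (2 ^ n) (\<lambda>(k, l). glauber n J (nth_config n k) (nth_config n l))"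

(* The eigenvalues of a real matrix, with algebraic multiplicity, in decreasing order. By
   reversibility all eigenvalues of glauber_matrix are real, so that this list has length 2^n,
   and algebraic and geometric multiplicities agree. *)
definition eigenvalues_desc :: "real mat \<Rightarrow> real list" where
  "eigenvalues_desc M = rev (sorted_list_of_multiset (proots (char_poly M)))"

(* mu n J k is the k-th largest eigenvalue, counted from k = 1. *)
definition mu :: "nat \<Rightarrow> (nat \<Rightarrow> real) \<Rightarrow> nat \<Rightarrow> real" where
  "mu n J k = eigenvalues_desc (glauber_matrix n J) ! (k - 1)"

definition relaxation_time :: "nat \<Rightarrow> (nat \<Rightarrow> real) \<Rightarrow> real" where
  "relaxation_time n J = 1 / (real n * (1 - mu n J 2))"

definition tau_star :: "nat \<Rightarrow> (nat \<Rightarrow> real) \<Rightarrow> real" where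
  "tau_star n J = relaxation_time n J - 1"

end

theory Submission
  imports Defs "HOL-Analysis.Function_Topology"
begin

text \<open>
  Put \<open>s\<^sub>i = sinh (2 J\<^sub>i)\<close>, \<open>c\<^sub>i = cosh (2 J\<^sub>i)\<close>, \<open>d\<^sub>i = c\<^sub>i\<^sub>-\<^sub>1 + c\<^sub>i\<close>. On the cycle the conditional mean of a spin is linear
  in its neighbours, \<open>(s\<^sub>i\<^sub>-\<^sub>1 \<sigma>\<^sub>i\<^sub>-\<^sub>1 + s\<^sub>i \<sigma>\<^sub>i\<^sub>+\<^sub>1) / d\<^sub>i\<close>, so the linear functions of the spins are invariant under
  the dynamics. Let \<open>x > 0\<close> and \<open>l\<close> solve \<open>s\<^sub>i\<^sub>-\<^sub>1 x\<^sub>i\<^sub>-\<^sub>1 + s\<^sub>i x\<^sub>i\<^sub>+\<^sub>1 = l d\<^sub>i x\<^sub>i\<close>. Then \<open>\<Sum> d\<^sub>i x\<^sub>i \<sigma>\<^sub>i\<close> is an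
  eigenfunction with eigenvalue \<open>1 - (1 - l) / n\<close>, and path coupling with weights \<open>d\<^sub>i x\<^sub>i\<close> shows that no
  eigenvalue other than the simple eigenvalue 1 exceeds it; hence \<open>\<tau>\<^sup>* = l / (1 - l)\<close>.

  Replacing \<open>s\<close> by \<open>k s\<close>, the claim is that \<open>k (1 / l - 1)\<close> is nonincreasing in \<open>k\<close>. As \<open>1 / l\<close> is the
  minimum of \<open>\<Sum> c\<^sub>i (y\<^sub>i\<^sup>2 + y\<^sub>i\<^sub>+\<^sub>1\<^sup>2) / \<Sum> 2 s\<^sub>i y\<^sub>i y\<^sub>i\<^sub>+\<^sub>1\<close>, attained at \<open>x\<close>, the first order change is nonpositive as
  soon as \<open>s\<^sub>i (x\<^sub>i\<^sup>2 + x\<^sub>i\<^sub>+\<^sub>1\<^sup>2) \<le> 2 c\<^sub>i x\<^sub>i x\<^sub>i\<^sub>+\<^sub>1\<close> on every edge, that is, as soon as \<open>x\<^sub>i\<^sub>+\<^sub>1 / x\<^sub>i\<close> lies between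
  \<open>tanh J\<^sub>i\<close> and its inverse. A violation of this would propagate around the cycle.
\<close>

subsection \<open>Perron pairs on the cycle\<close>

definition cyc_pred :: "nat \<Rightarrow> nat \<Rightarrow> nat" where
  "cyc_pred n i = (if i = 1 then n else i - 1)"

text \<open>With \<open>s i = sinh (2 * J i)\<close> this is \<open>cosh (2 * J i)\<close>.\<close>

definition edge_cosh :: "(nat \<Rightarrow> real) \<Rightarrow> nat \<Rightarrow> real" where
  "edge_cosh s i = sqrt (1 + (s i)\<^sup>2)"

definition cyc_deg :: "nat \<Rightarrow> (nat \<Rightarrow> real) \<Rightarrow> nat \<Rightarrow> real" where
  "cyc_deg n s i = edge_cosh s (cyc_pred n i) + edge_cosh s i"

definition cyc_adj :: "nat \<Rightarrow> (nat \<Rightarrow> real) \<Rightarrow> (nat \<Rightarrow> real) \<Rightarrow> nat \<Rightarrow> real" where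
  "cyc_adj n s x i = s (cyc_pred n i) * x (cyc_pred n i) + s i * x (cyc_succ n i)"

definition cyc_form :: "nat \<Rightarrow> (nat \<Rightarrow> real) \<Rightarrow> (nat \<Rightarrow> real) \<Rightarrow> real" where
  "cyc_form n s x = (\<Sum>i=1..n. 2 * s i * x i * x (cyc_succ n i))"

definition cyc_mass :: "nat \<Rightarrow> (nat \<Rightarrow> real) \<Rightarrow> (nat \<Rightarrow> real) \<Rightarrow> real" where
  "cyc_mass n s x = (\<Sum>i=1..n. cyc_deg n s i * (x i)\<^sup>2)"

text \<open>Generalized eigenproblem of \<open>cyc_adj\<close> relative to the diagonal weights
  \<open>cyc_deg\<close>. For positive \<open>s\<close>, positivity of \<open>x\<close> singles out
  the top eigenvalue.\<close>

definition perron_pair :: "nat \<Rightarrow> (nat \<Rightarrow> real) \<Rightarrow> (nat \<Rightarrow> real) \<Rightarrow> real \<Rightarrow> bool" where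
  "perron_pair n s x l \<longleftrightarrow>
     (\<forall>i\<in>{1..n}. x i > 0 \<and> cyc_adj n s x i = l * cyc_deg n s i * x i)"

lemma cyc_succ_in: "i \<in> {1..n} \<Longrightarrow> cyc_succ n i \<in> {1..n}"
  by (auto simp: cyc_succ_def)

lemma cyc_pred_in: "i \<in> {1..n} \<Longrightarrow> cyc_pred n i \<in> {1..n}"
  by (auto simp: cyc_pred_def)

lemma cyc_pred_succ: "i \<in> {1..n} \<Longrightarrow> cyc_pred n (cyc_succ n i) = i"
  by (auto simp: cyc_pred_def cyc_succ_def)

lemma cyc_succ_pred: "i \<in> {1..n} \<Longrightarrow> cyc_succ n (cyc_pred n i) = i"
  by (auto simp: cyc_pred_def cyc_succ_def)

lemma bij_betw_cyc_succ: "bij_betw (cyc_succ n) {1..n} {1..n}"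
  by (rule bij_betw_byWitness[where f' = "cyc_pred n"])
     (use cyc_succ_in cyc_pred_in cyc_pred_succ cyc_succ_pred in blast)+

lemma sum_cyc_succ: "(\<Sum>i=1..n. g (cyc_succ n i)) = (\<Sum>i=1..n. g i)"
  by (rule sum.reindex_bij_betw[OF bij_betw_cyc_succ])

text \<open>\<open>h\<close> takes both ends of an edge, so a sum over vertices and their
  predecessors becomes a sum over edges.\<close>

lemma sum_cyc_pred: "(\<Sum>i=1..n. h (cyc_pred n i) i) = (\<Sum>i=1..n. h i (cyc_succ n i))"
proof -
  have "(\<Sum>i=1..n. h (cyc_pred n i) i) = (\<Sum>i=1..n. h (cyc_pred n (cyc_succ n i)) (cyc_succ n i))"
    by (rule sum_cyc_succ[symmetric])
  also have "\<dots> = (\<Sum>i=1..n. h i (cyc_succ n i))"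
    by (rule sum.cong) (use cyc_pred_succ in auto)
  finally show ?thesis .
qed

text \<open>The property travels from \<open>i\<close> up to \<open>n\<close>, wraps to 1 and then
  travels up to \<open>j\<close>.\<close>

lemma cyc_induct:
  assumes "i \<in> {1..n}" "P i" "j \<in> {1..n}"
    and step: "\<And>i. i \<in> {1..n} \<Longrightarrow> P i \<Longrightarrow> P (cyc_succ n i)"
  shows "P j"
proof -
  have up: "P b" if "P a" "a \<le> b" "1 \<le> a" "b \<le> n" for a b
    using that(2,4)
  proof (induction b rule: dec_induct)
    case base
    show ?case by (rule that(1))
  next
    case (step m)
    with assms(4)[of m] that(3) show ?case by (simp add: cyc_succ_def)
  qed
  have "P n" using up[of i n] assms by auto
  then have "P 1" using step[of n] assms(1) by (auto simp: cyc_succ_def)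
  then show ?thesis using up[of 1 j] assms by auto
qed

lemma edge_cosh_ge1: "edge_cosh s i \<ge> 1"
  by (simp add: edge_cosh_def)

lemma edge_cosh_sq: "(edge_cosh s i)\<^sup>2 = 1 + (s i)\<^sup>2"
  by (simp add: edge_cosh_def)

lemma edge_cosh_gt: "s i < edge_cosh s i"
  by (simp add: edge_cosh_def real_less_rsqrt)

lemma cyc_deg_ge: "cyc_deg n s i \<ge> 2"
  unfolding cyc_deg_def using edge_cosh_ge1[of s i] edge_cosh_ge1[of s "cyc_pred n i"] by simp

lemma cyc_mass_edges:
  "cyc_mass n s x = (\<Sum>i=1..n. edge_cosh s i * ((x i)\<^sup>2 + (x (cyc_succ n i))\<^sup>2))"
proof -
  have "cyc_mass n s x = (\<Sum>i=1..n. edge_cosh s (cyc_pred n i) * (x i)\<^sup>2)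
      + (\<Sum>i=1..n. edge_cosh s i * (x i)\<^sup>2)"
    by (simp add: cyc_mass_def cyc_deg_def distrib_right sum.distrib)
  also have "(\<Sum>i=1..n. edge_cosh s (cyc_pred n i) * (x i)\<^sup>2)
      = (\<Sum>i=1..n. edge_cosh s i * (x (cyc_succ n i))\<^sup>2)"
    by (rule sum_cyc_pred)
  finally show ?thesis by (simp add: distrib_left sum.distrib add.commute)
qed

text \<open>Each edge is seen from both of its ends. The right-hand side is symmetric in
  \<open>x\<close> and \<open>z\<close>, so \<open>cyc_adj\<close> is self-adjoint.\<close>

lemma sum_mult_cyc_adj:
  "(\<Sum>i=1..n. z i * cyc_adj n s x i)
     = (\<Sum>i=1..n. s i * (x i * z (cyc_succ n i) + z i * x (cyc_succ n i)))"
proof -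
  have "(\<Sum>i=1..n. z i * cyc_adj n s x i)
      = (\<Sum>i=1..n. z i * (s (cyc_pred n i) * x (cyc_pred n i))) + (\<Sum>i=1..n. z i * (s i * x (cyc_succ n i)))"
    by (simp add: cyc_adj_def distrib_left sum.distrib)
  also have "(\<Sum>i=1..n. z i * (s (cyc_pred n i) * x (cyc_pred n i)))
      = (\<Sum>i=1..n. z (cyc_succ n i) * (s i * x i))"
    by (rule sum_cyc_pred)
  finally show ?thesis by (simp add: distrib_left sum.distrib algebra_simps)
qed

lemma cyc_form_adj: "cyc_form n s x = (\<Sum>i=1..n. x i * cyc_adj n s x i)"
  unfolding sum_mult_cyc_adj cyc_form_def by (rule sum.cong) (auto simp: algebra_simps)

lemma sum_cyc_adj_commute:
  "(\<Sum>i=1..n. z i * cyc_adj n s x i) = (\<Sum>i=1..n. x i * cyc_adj n s z i)"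
  unfolding sum_mult_cyc_adj by (rule sum.cong) (auto simp: algebra_simps)

lemma cyc_form_perturb:
  "cyc_form n s (\<lambda>i. x i + e * z i)
     = cyc_form n s x + 2 * e * (\<Sum>i=1..n. z i * cyc_adj n s x i) + e\<^sup>2 * cyc_form n s z"
  unfolding cyc_form_def sum_mult_cyc_adj sum_distrib_left sum.distrib[symmetric]
  by (rule sum.cong) (auto simp: algebra_simps power2_eq_square)

lemma cyc_mass_perturb:
  "cyc_mass n s (\<lambda>i. x i + e * z i)
     = cyc_mass n s x + 2 * e * (\<Sum>i=1..n. z i * (cyc_deg n s i * x i)) + e\<^sup>2 * cyc_mass n s z"
  unfolding cyc_mass_def sum_distrib_left sum.distrib[symmetric]
  by (rule sum.cong) (auto simp: algebra_simps power2_eq_square)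

lemma cyc_form_scale: "cyc_form n s (\<lambda>i. e * x i) = e\<^sup>2 * cyc_form n s x"
  unfolding cyc_form_def sum_distrib_left by (rule sum.cong) (auto simp: algebra_simps power2_eq_square)

lemma cyc_mass_scale: "cyc_mass n s (\<lambda>i. e * x i) = e\<^sup>2 * cyc_mass n s x"
  unfolding cyc_mass_def sum_distrib_left by (rule sum.cong) (auto simp: algebra_simps power2_eq_square)

lemma sq_le_cyc_mass: "i \<in> {1..n} \<Longrightarrow> (x i)\<^sup>2 \<le> cyc_mass n s x"
proof -
  assume i: "i \<in> {1..n}"
  have "(x i)\<^sup>2 \<le> cyc_deg n s i * (x i)\<^sup>2"
    using mult_right_mono[of 1 "cyc_deg n s i" "(x i)\<^sup>2"] cyc_deg_ge[of n s i] by simp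
  also have "\<dots> \<le> cyc_mass n s x"
    unfolding cyc_mass_def
    by (rule member_le_sum) (use i cyc_deg_ge[of n s] in \<open>auto intro!: mult_nonneg_nonneg\<close>, meson order.trans zero_le_numeral)
  finally show ?thesis .
qed

section \<open>Existence of a Perron pair\<close>

text \<open>A maximizer of \<open>cyc_form\<close> among nonnegative vectors of unit mass is
  critical, which is the eigenvalue equation; a zero entry would spread around the cycle.\<close>

lemma perron_pair_exists:
  assumes n: "n \<ge> 1" and s: "\<And>i. i \<in> {1..n} \<Longrightarrow> s i > 0"
  shows "\<exists>x l. perron_pair n s x l"
proof -
  \<comment> \<open>Entries outside the vertex set are pinned to 0, which makes the cube a product
    of compact sets over all of \<open>nat\<close>.\<close>
  define S where "S i = (if i \<in> {1..n} then {0..1::real} else {0})" for i :: nat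
  define K where "K = PiE UNIV S \<inter> {x. cyc_mass n s x = 1}"
  have cont_form: "continuous_on UNIV (cyc_form n s)" and cont_mass: "continuous_on UNIV (cyc_mass n s)"
    unfolding cyc_form_def cyc_mass_def by (intro continuous_intros; simp)+
  have "compactin (product_topology (\<lambda>i. euclidean) UNIV) (PiE UNIV S)"
    unfolding compactin_PiE by (auto simp: S_def)
  then have cpt: "compact (PiE UNIV S)"
    by (simp add: euclidean_product_topology)
  moreover have "closed {x. cyc_mass n s x = 1}"
    using closed_vimage[OF _ cont_mass, of "{1}"] by (simp add: vimage_def)
  ultimately have "compact K"
    unfolding K_def by (rule compact_Int_closed)
  have normalize: "(\<lambda>i. (1 / sqrt (cyc_mass n s y)) * (if i \<in> {1..n} then \<bar>y i\<bar> else 0)) \<in> K"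
    if "cyc_mass n s y > 0" for y
  proof -
    let ?m = "cyc_mass n s y"
    have "cyc_mass n s (\<lambda>i. if i \<in> {1..n} then \<bar>y i\<bar> else 0) = ?m"
      unfolding cyc_mass_def by (rule sum.cong) auto
    moreover have "\<bar>y i\<bar> \<le> sqrt ?m" if "i \<in> {1..n}" for i
      using sq_le_cyc_mass[OF that, of y s] real_le_rsqrt[of "\<bar>y i\<bar>"] by simp
    ultimately show ?thesis
      unfolding K_def Int_iff mem_Collect_eq cyc_mass_scale
      using that by (auto simp: S_def power_divide)
  qed
  have "cyc_mass n s (\<lambda>i. 1) \<ge> 1"
    using sq_le_cyc_mass[of 1 n "\<lambda>i. 1" s] n by simp
  then have "K \<noteq> {}" using normalize[of "\<lambda>i. 1"] by force
  then obtain x where x: "x \<in> K" and max: "\<And>y. y \<in> K \<Longrightarrow> cyc_form n s y \<le> cyc_form n s x"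
    using continuous_attains_sup[OF \<open>compact K\<close> _ continuous_on_subset[OF cont_form]] by blast
  define l where "l = cyc_form n s x"
  have mass_x: "cyc_mass n s x = 1" and x_nonneg: "\<And>i. i \<in> {1..n} \<Longrightarrow> x i \<ge> 0"
    using x by (auto simp: K_def S_def PiE_iff split: if_splits)
  \<comment> \<open>Maximality extends to all real vectors, since taking absolute values keeps the
    mass and does not decrease the form. A perturbation of \<open>x\<close> may thus leave the
    nonnegative cone.\<close>
  have bound: "cyc_form n s y \<le> l * cyc_mass n s y" for y
  proof (cases "cyc_mass n s y > 0")
    case True
    let ?z = "\<lambda>i. if i \<in> {1..n} then \<bar>y i\<bar> else 0"
    have "cyc_form n s y \<le> cyc_form n s ?z"
      unfolding cyc_form_def
    proof (rule sum_mono)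
      fix i assume i: "i \<in> {1..n}"
      have "y i * y (cyc_succ n i) \<le> \<bar>y i\<bar> * \<bar>y (cyc_succ n i)\<bar>"
        by (metis abs_ge_self abs_mult)
      then show "2 * s i * y i * y (cyc_succ n i) \<le> 2 * s i * ?z i * ?z (cyc_succ n i)"
        using i cyc_succ_in[OF i] s[OF i] by (simp add: mult.assoc)
    qed
    moreover have "cyc_form n s ?z / cyc_mass n s y \<le> l"
      using max[OF normalize[OF True]] True unfolding cyc_form_scale l_def by (simp add: power_divide)
    ultimately show ?thesis using True by (simp add: field_simps)
  next
    case False
    have "y i = 0" if "i \<in> {1..n}" for i
      using sq_le_cyc_mass[OF that, of y s] False by (smt (verit) zero_less_power2)
    then have "cyc_form n s y = 0" "cyc_mass n s y = 0"
      by (auto simp: cyc_form_def cyc_mass_def)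
    then show ?thesis by simp
  qed
  \<comment> \<open>Half the gradient of \<open>cyc_form - l * cyc_mass\<close> at
    \<open>x\<close>.\<close>
  define g where "g i = cyc_adj n s x i - l * (cyc_deg n s i * x i)" for i
  have "(\<Sum>i=1..n. (g i)\<^sup>2) \<le> 0"
  proof (rule ccontr)
    assume "\<not> ?thesis"
    then have G: "(\<Sum>i=1..n. (g i)\<^sup>2) > 0" by simp
    \<comment> \<open>\<open>D\<close> is positive and bounds the second-order coefficient, so a
      move by \<open>e\<close> along \<open>g\<close> loses at most half of its first-order
      gain.\<close>
    define D where "D = \<bar>l * cyc_mass n s g - cyc_form n s g\<bar> + 1"
    define e where "e = (\<Sum>i=1..n. (g i)\<^sup>2) / D"
    have D: "D > 0" by (simp add: D_def)
    have e: "e > 0" using G D by (simp add: e_def)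
    have "(\<Sum>i=1..n. g i * cyc_adj n s x i) - l * (\<Sum>i=1..n. g i * (cyc_deg n s i * x i))
        = (\<Sum>i=1..n. (g i)\<^sup>2)"
      unfolding sum_distrib_left sum_subtractf[symmetric]
      by (rule sum.cong) (auto simp: g_def power2_eq_square algebra_simps)
    moreover have "cyc_form n s x + 2 * e * (\<Sum>i=1..n. g i * cyc_adj n s x i) + e\<^sup>2 * cyc_form n s g
        \<le> l * (cyc_mass n s x + 2 * e * (\<Sum>i=1..n. g i * (cyc_deg n s i * x i)) + e\<^sup>2 * cyc_mass n s g)"
      using bound[of "\<lambda>i. x i + e * g i"] unfolding cyc_form_perturb cyc_mass_perturb .
    ultimately have "e * (2 * (\<Sum>i=1..n. (g i)\<^sup>2)) \<le> e * (e * (l * cyc_mass n s g - cyc_form n s g))"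
      using mass_x by (simp add: l_def[symmetric] algebra_simps power2_eq_square)
    then have "2 * (\<Sum>i=1..n. (g i)\<^sup>2) \<le> e * (l * cyc_mass n s g - cyc_form n s g)"
      using e by simp
    also have "\<dots> \<le> e * D" using e by (intro mult_left_mono) (auto simp: D_def)
    also have "\<dots> = (\<Sum>i=1..n. (g i)\<^sup>2)" using D by (simp add: e_def)
    finally show False using G by simp
  qed
  then have "(\<Sum>i=1..n. (g i)\<^sup>2) = 0" by (simp add: order_antisym sum_nonneg)
  then have eq: "cyc_adj n s x i = l * cyc_deg n s i * x i" if "i \<in> {1..n}" for i
    using that by (auto simp: sum_nonneg_eq_0_iff g_def)
  have pos: "x i > 0" if "i \<in> {1..n}" for i
  proof (rule ccontr)
    assume "\<not> ?thesis"
    then have xi: "x i = 0" using x_nonneg[OF that] by simp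
    have "x j = 0" if "j \<in> {1..n}" for j
    proof (rule cyc_induct[where P = "\<lambda>j. x j = 0", OF \<open>i \<in> {1..n}\<close> xi that])
      fix j assume j: "j \<in> {1..n}" "x j = 0"
      have "s (cyc_pred n j) * x (cyc_pred n j) + s j * x (cyc_succ n j) = 0"
        using eq[OF j(1)] j(2) by (simp add: cyc_adj_def)
      moreover have "s (cyc_pred n j) * x (cyc_pred n j) \<ge> 0" "s j * x (cyc_succ n j) \<ge> 0" "s j > 0"
        using s[OF j(1)] s[OF cyc_pred_in[OF j(1)]] x_nonneg[OF cyc_pred_in[OF j(1)]] x_nonneg[OF cyc_succ_in[OF j(1)]]
        by auto
      ultimately show "x (cyc_succ n j) = 0" by (smt (verit) mult_eq_0_iff)
    qed
    then have "cyc_mass n s x = 0" by (simp add: cyc_mass_def)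
    with mass_x show False by simp
  qed
  have "perron_pair n s x l" using eq pos by (auto simp: perron_pair_def)
  then show ?thesis by blast
qed

section \<open>Variational bound and range of the eigenvalue\<close>

lemma perron_pair_form: "perron_pair n s x l \<Longrightarrow> cyc_form n s x = l * cyc_mass n s x"
  unfolding cyc_form_adj cyc_mass_def sum_distrib_left perron_pair_def
  by (rule sum.cong) (auto simp: power2_eq_square)

text \<open>Pair the eigenvalue equation with \<open>(y i)\<^sup>2 / x i\<close>, as in Picone's
  inequality. Together with \<open>perron_pair_form\<close> this makes \<open>l\<close> the maximum
  of form over mass.\<close>

lemma perron_pair_bound:
  assumes s: "\<And>i. i \<in> {1..n} \<Longrightarrow> s i > 0" and x: "perron_pair n s x l"
  shows "cyc_form n s y \<le> l * cyc_mass n s y"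
proof -
  define z where "z i = (y i)\<^sup>2 / x i" for i
  have pos: "x i > 0" if "i \<in> {1..n}" for i using x that by (simp add: perron_pair_def)
  have "cyc_form n s y \<le> (\<Sum>i=1..n. s i * (x i * z (cyc_succ n i) + z i * x (cyc_succ n i)))"
    unfolding cyc_form_def
  proof (rule sum_mono)
    fix i assume i: "i \<in> {1..n}"
    let ?j = "cyc_succ n i"
    have xi: "x i > 0" and xj: "x ?j > 0" using pos i cyc_succ_in[OF i] by auto
    have "x i * x ?j * (y i / x i - y ?j / x ?j)\<^sup>2 \<ge> 0"
      using xi xj by simp
    moreover have "x i * x ?j * (y i / x i - y ?j / x ?j)\<^sup>2
        = x i * z ?j + z i * x ?j - 2 * y i * y ?j"
      using xi xj by (simp add: z_def power2_eq_square field_simps)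
    ultimately have "2 * y i * y ?j \<le> x i * z ?j + z i * x ?j" by simp
    from mult_left_mono[OF this, of "s i"] s[OF i]
    show "2 * s i * y i * y ?j \<le> s i * (x i * z ?j + z i * x ?j)"
      by (simp add: algebra_simps)
  qed
  also have "\<dots> = (\<Sum>i=1..n. z i * cyc_adj n s x i)" by (rule sum_mult_cyc_adj[symmetric])
  also have "\<dots> = l * cyc_mass n s y"
    unfolding cyc_mass_def sum_distrib_left
  proof (rule sum.cong)
    fix i assume i: "i \<in> {1..n}"
    then have "cyc_adj n s x i = l * cyc_deg n s i * x i" using x by (simp add: perron_pair_def)
    then show "z i * cyc_adj n s x i = l * (cyc_deg n s i * (y i)\<^sup>2)"
      using pos[OF i] by (simp add: z_def)
  qed simp
  finally show ?thesis .
qed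

lemma cyc_form_pos:
  assumes "n \<ge> 1" "\<And>i. i \<in> {1..n} \<Longrightarrow> s i > 0" "\<And>i. i \<in> {1..n} \<Longrightarrow> x i > 0"
  shows "cyc_form n s x > 0"
  unfolding cyc_form_def
  by (rule sum_pos) (use assms cyc_succ_in in auto)

lemma perron_pair_range:
  assumes n: "n \<ge> 1" and s: "\<And>i. i \<in> {1..n} \<Longrightarrow> s i > 0" and x: "perron_pair n s x l"
  shows "0 < l" "l < 1"
proof -
  have pos: "x i > 0" if "i \<in> {1..n}" for i using x that by (simp add: perron_pair_def)
  have "cyc_form n s x < cyc_mass n s x"
    unfolding cyc_form_def cyc_mass_edges
  proof (rule sum_strict_mono)
    fix i assume i: "i \<in> {1..n}"
    let ?j = "cyc_succ n i"
    have "2 * s i * x i * x ?j = s i * (2 * x i * x ?j)" by simp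
    also have "\<dots> \<le> s i * ((x i)\<^sup>2 + (x ?j)\<^sup>2)"
      using s[OF i] sum_squares_bound[of "x i" "x ?j"] by (intro mult_left_mono) auto
    also have "\<dots> < edge_cosh s i * ((x i)\<^sup>2 + (x ?j)\<^sup>2)"
      using edge_cosh_gt[of s i] pos[OF i] by (intro mult_strict_right_mono) (auto intro: add_pos_nonneg)
    finally show "2 * s i * x i * x ?j < edge_cosh s i * ((x i)\<^sup>2 + (x ?j)\<^sup>2)" .
  qed (use n in auto)
  moreover have "cyc_form n s x > 0" by (rule cyc_form_pos) (use n s pos in auto)
  ultimately show "0 < l" "l < 1"
    using perron_pair_form[OF x] by (auto simp: zero_less_mult_iff)
qed

section \<open>Ratios of neighbouring entries\<close>

text \<open>Since \<open>(cosh (2 * J) - 1) / sinh (2 * J) = tanh J\<close>, the two bounds place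
  the ratio between \<open>tanh J\<close> and its inverse. A violation passes from edge to edge in
  one direction and makes \<open>x\<close> strictly monotone around the cycle, which is
  impossible.\<close>

lemma perron_pair_ratio:
  assumes n: "n \<ge> 1" and s: "\<And>i. i \<in> {1..n} \<Longrightarrow> s i > 0" and x: "perron_pair n s x l"
    and i: "i \<in> {1..n}"
  shows "s i * x (cyc_succ n i) \<ge> (edge_cosh s i - 1) * x i"
    and "s i * x i \<ge> (edge_cosh s i - 1) * x (cyc_succ n i)"
proof -
  let ?c = "edge_cosh s" and ?S = "cyc_succ n" and ?P = "cyc_pred n"
  have pos: "x i > 0" if "i \<in> {1..n}" for i using x that by (simp add: perron_pair_def)
  have l: "l < 1" using perron_pair_range[OF n s x] by simp
  have sq: "(?c i - 1) * (?c i + 1) = (s i)\<^sup>2" for i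
    using edge_cosh_sq[of s i] by (simp add: algebra_simps power2_eq_square)
  have adj: "s (?P j) * x (?P j) + s j * x (?S j) < (?c (?P j) + ?c j) * x j" if "j \<in> {1..n}" for j
  proof -
    have "s (?P j) * x (?P j) + s j * x (?S j) = l * (cyc_deg n s j * x j)"
      using x that by (simp add: perron_pair_def cyc_adj_def)
    also have "\<dots> < 1 * (cyc_deg n s j * x j)"
      using l pos[OF that] cyc_deg_ge[of n s j] by (intro mult_strict_right_mono) auto
    finally show ?thesis by (simp add: cyc_deg_def)
  qed
  \<comment> \<open>By \<open>sq\<close>, \<open>(c - 1) / s = s / (c + 1)\<close>; this rewrites a
    violation in a form that combines with the vertex inequality \<open>adj\<close>.\<close>
  have flip: "(?c j + 1) * v < s j * u" if "s j * v < (?c j - 1) * u" "j \<in> {1..n}" for j u v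
  proof -
    have "s j * ((?c j + 1) * v) < s j * (s j * u)"
      using mult_strict_left_mono[OF that(1), of "?c j + 1"] edge_cosh_ge1[of s j] sq[of j]
      by (simp add: algebra_simps power2_eq_square)
    then show ?thesis using s[OF that(2)] by simp
  qed
  \<comment> \<open>Since \<open>c - 1 < s\<close>, a violated edge forces a strict change of
    \<open>x\<close> along it.\<close>
  have drop: "v < u" if "s j * v < (?c j - 1) * u" "j \<in> {1..n}" "u > 0" for j u v
  proof -
    have "(?c j - 1) * u < s j * u"
    proof (rule mult_strict_right_mono)
      have "(?c j)\<^sup>2 < (s j + 1)\<^sup>2"
        using s[OF that(2)] by (simp add: edge_cosh_sq power2_sum)
      then show "?c j - 1 < s j" using s[OF that(2)] power2_less_imp_less by fastforce
    qed (rule that(3))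
    with that(1) have "s j * v < s j * u" by simp
    then show ?thesis using s[OF that(2)] by simp
  qed
  have sum_eq: "(\<Sum>j=1..n. x (?S j)) = (\<Sum>j=1..n. x j)" by (rule sum_cyc_succ)
  have nonempty: "{1..n} \<noteq> {}" using n by auto
  show "s i * x (?S i) \<ge> (?c i - 1) * x i"
  proof (rule ccontr)
    assume "\<not> ?thesis"
    then have start: "s i * x (?S i) < (?c i - 1) * x i" by simp
    have all: "s j * x (?S j) < (?c j - 1) * x j" if "j \<in> {1..n}" for j
    proof (rule cyc_induct[where P = "\<lambda>j. s j * x (?S j) < (?c j - 1) * x j", OF i start that])
      fix j assume j: "j \<in> {1..n}" and "s j * x (?S j) < (?c j - 1) * x j"
      from flip[OF this(2) j] have "(?c j + 1) * x (?S j) < s j * x j" .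
      with adj[OF cyc_succ_in[OF j]]
      show "s (?S j) * x (?S (?S j)) < (?c (?S j) - 1) * x (?S j)"
        by (simp add: cyc_pred_succ[OF j] algebra_simps)
    qed
    have "(\<Sum>j=1..n. x (?S j)) < (\<Sum>j=1..n. x j)"
      using drop[OF all _ pos] nonempty by (intro sum_strict_mono) auto
    with sum_eq show False by simp
  qed
  show "s i * x i \<ge> (?c i - 1) * x (?S i)"
  proof (rule ccontr)
    assume not: "\<not> ?thesis"
    \<comment> \<open>Violations of this bound travel backwards. The forward induction uses the
      contrapositive: one edge satisfying the bound would make edge \<open>i\<close> satisfy
      it.\<close>
    have all: "s j * x j < (?c j - 1) * x (?S j)" if j: "j \<in> {1..n}" for j
    proof (rule ccontr)
      assume "\<not> ?thesis"
      then have start: "s j * x j \<ge> (?c j - 1) * x (?S j)" by simp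
      have "s i * x i \<ge> (?c i - 1) * x (?S i)"
      proof (rule cyc_induct[where P = "\<lambda>j. s j * x j \<ge> (?c j - 1) * x (?S j)", OF j start i])
        fix j assume j: "j \<in> {1..n}" and ge: "s j * x j \<ge> (?c j - 1) * x (?S j)"
        show "s (?S j) * x (?S j) \<ge> (?c (?S j) - 1) * x (?S (?S j))"
        proof (rule ccontr)
          assume "\<not> ?thesis"
          then have "(?c (?S j) + 1) * x (?S j) < s (?S j) * x (?S (?S j))"
            by (intro flip cyc_succ_in j) simp
          with adj[OF cyc_succ_in[OF j]] ge show False
            by (simp add: cyc_pred_succ[OF j] algebra_simps)
        qed
      qed
      with not show False by simp
    qed
    have "(\<Sum>j=1..n. x j) < (\<Sum>j=1..n. x (?S j))"
      using drop[OF all _ pos[OF cyc_succ_in]] nonempty by (intro sum_strict_mono) auto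
    with sum_eq show False by simp
  qed
qed

text \<open>The quadratic \<open>s * r\<^sup>2 - 2 * c * r + s\<close> has the roots
  \<open>(c - 1) / s\<close> and \<open>(c + 1) / s\<close>, and the ratio of neighbours lies
  between them.\<close>

lemma perron_pair_edge:
  assumes n: "n \<ge> 1" and s: "\<And>i. i \<in> {1..n} \<Longrightarrow> s i > 0" and x: "perron_pair n s x l"
    and i: "i \<in> {1..n}"
  shows "s i * ((x i)\<^sup>2 + (x (cyc_succ n i))\<^sup>2) \<le> edge_cosh s i * (2 * x i * x (cyc_succ n i))"
proof -
  let ?c = "edge_cosh s i" and ?u = "x i" and ?v = "x (cyc_succ n i)"
  have c: "?c > 1" using s[OF i] by (simp add: edge_cosh_def)
  have s2: "s i * s i = ?c * ?c - 1" using edge_cosh_sq[of s i] by (simp add: power2_eq_square)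
  have "0 \<le> (s i * ?v - (?c - 1) * ?u) * (s i * ?u - (?c - 1) * ?v)"
    using perron_pair_ratio[OF n s x i] by simp
  also have "\<dots> = (s i * s i) * ?u * ?v - s i * (?c - 1) * (?u\<^sup>2 + ?v\<^sup>2) + (?c - 1)\<^sup>2 * ?u * ?v"
    by (simp add: power2_eq_square algebra_simps)
  also have "\<dots> = (?c - 1) * (?c * (2 * ?u * ?v) - s i * (?u\<^sup>2 + ?v\<^sup>2))"
    unfolding s2 by (simp add: power2_eq_square algebra_simps)
  finally show ?thesis using c by (simp add: zero_le_mult_iff)
qed

section \<open>Monotonicity under scaling of \<open>s\<close>\<close>

text \<open>Tangent line at \<open>a\<close> plus an explicit quadratic remainder, from
  \<open>2 * A * B \<le> A\<^sup>2 + B\<^sup>2\<close> for the two square roots.\<close>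

lemma sqrt_one_plus_sq_upper:
  "sqrt (1 + b\<^sup>2) \<le> sqrt (1 + a\<^sup>2) + (b - a) * a / sqrt (1 + a\<^sup>2) + (b - a)\<^sup>2 / (2 * sqrt (1 + a\<^sup>2))"
proof -
  let ?A = "sqrt (1 + a\<^sup>2)" and ?B = "sqrt (1 + b\<^sup>2)"
  have A: "?A > 0" by (simp add: add_pos_nonneg)
  have sq: "?A\<^sup>2 = 1 + a\<^sup>2" "?B\<^sup>2 = 1 + b\<^sup>2" by auto
  have "2 * ?A * ?B \<le> ?A\<^sup>2 + ?B\<^sup>2" by (rule sum_squares_bound)
  also have "\<dots> = 2 * ?A\<^sup>2 + 2 * (b - a) * a + (b - a)\<^sup>2"
    unfolding sq by (simp add: power2_eq_square algebra_simps)
  finally have "?B \<le> (2 * ?A\<^sup>2 + 2 * (b - a) * a + (b - a)\<^sup>2) / (2 * ?A)"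
    using A by (simp add: field_simps)
  also have "\<dots> = ?A + (b - a) * a / ?A + (b - a)\<^sup>2 / (2 * ?A)"
    using A by (simp add: field_simps power2_eq_square)
  finally show ?thesis .
qed

text \<open>\<open>x\<close>, optimal at scale \<open>a\<close>, serves as test vector at scale
  \<open>b\<close>. The form is linear in the scale, and by \<open>perron_pair_edge\<close> the mass
  grows to first order by at most \<open>(b - a) * F\<close>. This is offset by the subtracted terms
  \<open>b\<close> and \<open>a\<close>, so only a quadratic error remains.\<close>

lemma perron_pair_scale_step:
  assumes n: "n \<ge> 1" and s: "\<And>i. i \<in> {1..n} \<Longrightarrow> s i > 0"
    and a: "1 \<le> a" and ab: "a \<le> b"
    and x: "perron_pair n (\<lambda>i. a * s i) x l" and x': "perron_pair n (\<lambda>i. b * s i) x' l'"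
  shows "b * (1 / l' - 1) \<le> a * (1 / l - 1) + (b - a)\<^sup>2"
proof -
  let ?S = "cyc_succ n"
  have sa: "a * s i > 0" and sb: "b * s i > 0" if "i \<in> {1..n}" for i using s[OF that] a ab by auto
  have l: "l > 0" and l': "l' > 0"
    using perron_pair_range(1)[OF n _ x] perron_pair_range(1)[OF n _ x'] sa sb by auto
  define F where "F = cyc_form n s x"
  have form: "cyc_form n (\<lambda>i. k * s i) x = k * F" for k
    unfolding F_def cyc_form_def sum_distrib_left by (rule sum.cong) auto
  have F: "F > 0" unfolding F_def using x by (intro cyc_form_pos n s) (auto simp: perron_pair_def)
  have "cyc_mass n (\<lambda>i. b * s i) x - cyc_mass n (\<lambda>i. a * s i) x
      \<le> (\<Sum>i=1..n. (b - a + (b - a)\<^sup>2) * (2 * s i * x i * x (?S i)))"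
    unfolding cyc_mass_edges sum_subtractf[symmetric]
  proof (rule sum_mono)
    fix i assume i: "i \<in> {1..n}"
    let ?A = "edge_cosh (\<lambda>i. a * s i) i" and ?B = "edge_cosh (\<lambda>i. b * s i) i"
    let ?N = "(x i)\<^sup>2 + (x (?S i))\<^sup>2" and ?X = "2 * x i * x (?S i)"
    have A: "?A > 0" using edge_cosh_ge1[of "\<lambda>i. a * s i" i] by simp
    have edge: "a * s i * ?N \<le> ?A * ?X" using perron_pair_edge[OF n _ x i] sa by simp
    then have N1: "a * s i / ?A * ?N \<le> ?X" using A by (simp add: field_simps)
    have "0 \<le> s i * ?N" using s[OF i] by simp
    \<comment> \<open>Here \<open>1 \<le> a\<close> removes a factor \<open>a\<close>, so the
      coefficient of the quadratic error depends neither on \<open>s\<close> nor on the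
      scale.\<close>
    then have "s i * ?N \<le> a * s i * ?N"
      using mult_right_mono[OF a, of "s i * ?N"] by (simp add: mult.assoc)
    with N1 have N2: "s i * ?N / ?A \<le> ?X" using A edge by (simp add: field_simps)
    have N2': "s i * ?N / (2 * ?A) \<le> ?X"
    proof -
      have "s i * ?N / (2 * ?A) \<le> s i * ?N / ?A"
        using \<open>0 \<le> s i * ?N\<close> A by (intro divide_left_mono) auto
      with N2 show ?thesis by simp
    qed
    have "?B - ?A \<le> (b - a) * s i * (a * s i / ?A) + ((b - a) * s i)\<^sup>2 / (2 * ?A)"
      using sqrt_one_plus_sq_upper[of "b * s i" "a * s i"]
      by (simp add: edge_cosh_def algebra_simps)
    then have "(?B - ?A) * ?N \<le> ((b - a) * s i * (a * s i / ?A) + ((b - a) * s i)\<^sup>2 / (2 * ?A)) * ?N"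
      by (rule mult_right_mono) simp
    also have "\<dots> = (b - a) * s i * (a * s i / ?A * ?N) + (b - a)\<^sup>2 * s i * (s i * ?N / (2 * ?A))"
      by (simp add: algebra_simps power2_eq_square add_divide_distrib diff_divide_distrib)
    also have "\<dots> \<le> (b - a) * s i * ?X + (b - a)\<^sup>2 * s i * ?X"
      using N1 N2' s[OF i] ab by (intro add_mono mult_left_mono) auto
    finally show "?B * ?N - ?A * ?N \<le> (b - a + (b - a)\<^sup>2) * (2 * s i * x i * x (?S i))"
      by (simp add: algebra_simps)
  qed
  also have "\<dots> = (b - a + (b - a)\<^sup>2) * F"
    by (simp add: F_def cyc_form_def sum_distrib_left)
  finally have mass: "cyc_mass n (\<lambda>i. b * s i) x \<le> cyc_mass n (\<lambda>i. a * s i) x + (b - a + (b - a)\<^sup>2) * F"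
    by simp
  have "b * F \<le> l' * cyc_mass n (\<lambda>i. b * s i) x"
    using perron_pair_bound[OF _ x', of x] sb unfolding form by simp
  then have "b / l' \<le> cyc_mass n (\<lambda>i. b * s i) x / F"
    using l' F by (simp add: field_simps)
  also have "\<dots> \<le> (cyc_mass n (\<lambda>i. a * s i) x + (b - a + (b - a)\<^sup>2) * F) / F"
    using mass F by (intro divide_right_mono) auto
  also have "\<dots> = a / l + (b - a + (b - a)\<^sup>2)"
  proof -
    have "a * F = l * cyc_mass n (\<lambda>i. a * s i) x" using perron_pair_form[OF x] unfolding form .
    then have "cyc_mass n (\<lambda>i. a * s i) x / F = a / l" using F l by (simp add: field_simps)
    then show ?thesis using F by (simp add: add_divide_distrib)
  qed
  finally show ?thesis by (simp add: algebra_simps)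
qed

text \<open>Cut the interval into \<open>m\<close> pieces: the total increment is at most \<open>(b - a)\<^sup>2 / m\<close>.\<close>

lemma antimono_of_quadratic_increments:
  fixes G :: "real \<Rightarrow> real"
  assumes step: "\<And>u v. a \<le> u \<Longrightarrow> u \<le> v \<Longrightarrow> G v \<le> G u + (v - u)\<^sup>2" and ab: "a \<le> b"
  shows "G b \<le> G a"
proof -
  have bound: "G b - G a \<le> (b - a)\<^sup>2 * (1 / real (Suc m))" for m
  proof -
    define h where "h = (b - a) / real (Suc m)"
    have h: "h \<ge> 0" using ab by (simp add: h_def)
    have "G (a + real k * h) \<le> G a + real k * h\<^sup>2" for k
    proof (induction k)
      case (Suc k)
      have "G (a + real (Suc k) * h) \<le> G (a + real k * h) + h\<^sup>2"
        using step[of "a + real k * h" "a + real (Suc k) * h"] h by (simp add: algebra_simps)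
      with Suc show ?case by (simp add: algebra_simps)
    qed simp
    from this[of "Suc m"] have "G b \<le> G a + real (Suc m) * h\<^sup>2" by (simp add: h_def)
    also have "real (Suc m) * h\<^sup>2 = (b - a)\<^sup>2 * (1 / real (Suc m))"
      by (simp add: h_def power2_eq_square field_simps del: of_nat_Suc)
    finally show ?thesis by simp
  qed
  have "(\<lambda>m. (b - a)\<^sup>2 * (1 / real (Suc m))) \<longlonglongrightarrow> (b - a)\<^sup>2 * 0"
    by (intro tendsto_mult_left LIMSEQ_Suc[OF lim_1_over_n])
  then have "G b - G a \<le> (b - a)\<^sup>2 * 0"
    by (rule LIMSEQ_le_const) (use bound in blast)
  then show ?thesis by simp
qed

text \<open>The quantity \<open>r * (1 / l - 1)\<close> at scale \<open>r\<close> is nonincreasing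
  in \<open>r\<close>; comparing \<open>r = 1\<close> with \<open>r = k\<close> and inverting gives
  the claim.\<close>

lemma perron_pair_scale:
  assumes n: "n \<ge> 1" and s: "\<And>i. i \<in> {1..n} \<Longrightarrow> s i > 0" and k: "1 \<le> k"
    and x: "perron_pair n s x l" and x': "perron_pair n (\<lambda>i. k * s i) x' l'"
  shows "k * (l / (1 - l)) \<le> l' / (1 - l')"
proof -
  define L where "L r = (SOME m. \<exists>y. perron_pair n (\<lambda>i. r * s i) y m)" for r :: real
  \<comment> \<open>Away from the endpoints any eigenvalue may be chosen; at the endpoints
    \<open>G\<close> is tied to the given ones.\<close>
  define G where "G r = (if r = 1 then 1 / l - 1 else if r = k then k * (1 / l' - 1) else r * (1 / L r - 1))" for r
  have ex: "\<exists>y m. perron_pair n (\<lambda>i. r * s i) y m \<and> G r = r * (1 / m - 1)" if "r \<ge> 1" for r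
  proof -
    have "\<exists>m y. perron_pair n (\<lambda>i. r * s i) y m"
      using perron_pair_exists[OF n, of "\<lambda>i. r * s i"] s that by fastforce
    then have "\<exists>y. perron_pair n (\<lambda>i. r * s i) y (L r)" unfolding L_def by (rule someI_ex)
    then show ?thesis using x x' by (auto simp: G_def)
  qed
  have "G k \<le> G 1"
  proof (rule antimono_of_quadratic_increments[OF _ k])
    fix u v :: real assume uv: "1 \<le> u" "u \<le> v"
    obtain y m where 1: "perron_pair n (\<lambda>i. u * s i) y m" "G u = u * (1 / m - 1)" using ex uv by blast
    obtain y' m' where 2: "perron_pair n (\<lambda>i. v * s i) y' m'" "G v = v * (1 / m' - 1)"
      using ex[of v] uv by auto
    show "G v \<le> G u + (v - u)\<^sup>2"
      unfolding 1(2) 2(2) by (rule perron_pair_scale_step[OF n s uv 1(1) 2(1)])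
  qed
  \<comment> \<open>For \<open>k = 1\<close> the endpoints coincide and \<open>G\<close> refers to
    \<open>l\<close>; a step of length zero then compares \<open>l'\<close> with
    \<open>l\<close>.\<close>
  moreover have "k * (1 / l' - 1) \<le> G k"
  proof (cases "k = 1")
    case True
    have "1 / l' - 1 \<le> 1 / l - 1"
      using perron_pair_scale_step[OF n s, where a = 1 and b = 1 and x = x and l = l and x' = x' and l' = l'] x x' True by simp
    then show ?thesis using True by (simp add: G_def)
  qed (simp add: G_def)
  ultimately have le: "k * (1 / l' - 1) \<le> 1 / l - 1" by (simp add: G_def)
  have "0 < l" "l < 1" using perron_pair_range[OF n s x] by auto
  moreover have "0 < l'" "l' < 1" using perron_pair_range[OF n _ x'] s k by auto
  ultimately show ?thesis using le by (simp add: field_simps)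
qed

subsection \<open>Heat-bath dynamics\<close>

text \<open>Resampling of the spin at \<open>i\<close>: a spin of mean \<open>m\<close> is +1 or -1
  with probability \<open>(1 + m) / 2\<close> or \<open>(1 - m) / 2\<close>, and \<open>m\<close> is
  linear in the neighbouring spins.\<close>

definition heat_bath :: "nat \<Rightarrow> (nat \<Rightarrow> real) \<Rightarrow> nat \<Rightarrow> ((nat \<Rightarrow> real) \<Rightarrow> real) \<Rightarrow> (nat \<Rightarrow> real) \<Rightarrow> real" where
  "heat_bath n s i f \<sigma> =
     (1 + cyc_adj n s \<sigma> i / cyc_deg n s i) / 2 * f (\<sigma>(i := 1))
     + (1 - cyc_adj n s \<sigma> i / cyc_deg n s i) / 2 * f (\<sigma>(i := - 1))"

definition heat_bath_avg :: "nat \<Rightarrow> (nat \<Rightarrow> real) \<Rightarrow> ((nat \<Rightarrow> real) \<Rightarrow> real) \<Rightarrow> (nat \<Rightarrow> real) \<Rightarrow> real" where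
  "heat_bath_avg n s f \<sigma> = (\<Sum>i=1..n. heat_bath n s i f \<sigma>) / real n"

lemma config_cases: "\<sigma> \<in> configs n \<Longrightarrow> i \<in> {1..n} \<Longrightarrow> \<sigma> i = 1 \<or> \<sigma> i = - 1"
  by (auto simp: configs_def)

lemma config_upd: "\<sigma> \<in> configs n \<Longrightarrow> i \<in> {1..n} \<Longrightarrow> c = 1 \<or> c = - 1 \<Longrightarrow> \<sigma>(i := c) \<in> configs n"
  by (auto simp: configs_def PiE_iff extensional_def)

lemma flip_in_configs: "\<sigma> \<in> configs n \<Longrightarrow> i \<in> {1..n} \<Longrightarrow> flip_spin i \<sigma> \<in> configs n"
  unfolding flip_spin_def using config_cases[of \<sigma> n i] by (intro config_upd) auto

lemma flip_neq: "\<sigma> \<in> configs n \<Longrightarrow> i \<in> {1..n} \<Longrightarrow> flip_spin i \<sigma> \<noteq> \<sigma>"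
  using config_cases[of \<sigma> n i] by (auto simp: flip_spin_def fun_eq_iff)

lemma finite_configs: "finite (configs n)"
  unfolding configs_def by (rule finite_PiE) auto

lemma cyc_succ_neq: "n \<ge> 2 \<Longrightarrow> i \<in> {1..n} \<Longrightarrow> cyc_succ n i \<noteq> i"
  by (auto simp: cyc_succ_def)

lemma cyc_pred_neq: "n \<ge> 2 \<Longrightarrow> i \<in> {1..n} \<Longrightarrow> cyc_pred n i \<noteq> i"
  by (auto simp: cyc_pred_def)

lemma cyc_adj_upd_self:
  "n \<ge> 2 \<Longrightarrow> i \<in> {1..n} \<Longrightarrow> cyc_adj n s (\<sigma>(i := c)) i = cyc_adj n s \<sigma> i"
  using cyc_succ_neq cyc_pred_neq by (simp add: cyc_adj_def)

lemma abs_cyc_adj_le: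
  assumes s: "\<And>i. i \<in> {1..n} \<Longrightarrow> s i > 0" and \<sigma>: "\<sigma> \<in> configs n" and i: "i \<in> {1..n}"
  shows "\<bar>cyc_adj n s \<sigma> i\<bar> \<le> cyc_deg n s i"
proof -
  have "s (cyc_pred n i) < edge_cosh s (cyc_pred n i)" "s i < edge_cosh s i"
    by (rule edge_cosh_gt)+
  then show ?thesis
    using config_cases[OF \<sigma> cyc_pred_in[OF i]] config_cases[OF \<sigma> cyc_succ_in[OF i]]
      s[OF i] s[OF cyc_pred_in[OF i]]
    by (auto simp: cyc_adj_def cyc_deg_def)
qed

lemma edge_cosh_sinh: "edge_cosh (\<lambda>i. sinh (2 * J i)) i = cosh (2 * J i)"
proof -
  have "1 + (sinh (2 * J i))\<^sup>2 = (cosh (2 * J i))\<^sup>2" by (simp add: cosh_square_eq)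
  then show ?thesis by (simp add: edge_cosh_def cosh_real_nonneg)
qed

text \<open>Both sides equal \<open>(1 - tanh (a + b)) / 2\<close>: on the right, the sum-to-product
  formulas give a common factor \<open>2 * cosh (a - b)\<close>.\<close>

lemma heat_bath_ratio:
  fixes a b :: real
  shows "exp (- (a + b)) / (exp (a + b) + exp (- (a + b)))
     = (1 - (sinh (2 * a) + sinh (2 * b)) / (cosh (2 * a) + cosh (2 * b))) / 2"
proof -
  have pos: "cosh (a + b) > 0" "cosh (a - b) > 0" by (rule cosh_real_pos)+
  have eq: "2 * a = (a + b) + (a - b)" "2 * b = (a + b) - (a - b)" by simp_all
  have "sinh (2 * a) + sinh (2 * b) = 2 * sinh (a + b) * cosh (a - b)"
    unfolding eq sinh_add[of "a + b" "a - b"] sinh_diff[of "a + b" "a - b"] by simp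
  moreover have "cosh (2 * a) + cosh (2 * b) = 2 * cosh (a + b) * cosh (a - b)"
    unfolding eq cosh_add[of "a + b" "a - b"] cosh_diff[of "a + b" "a - b"] by simp
  ultimately have "(sinh (2 * a) + sinh (2 * b)) / (cosh (2 * a) + cosh (2 * b)) = sinh (a + b) / cosh (a + b)"
    using pos by simp
  moreover have "exp (- (a + b)) = cosh (a + b) - sinh (a + b)" by (rule cosh_minus_sinh[symmetric])
  moreover have "exp (a + b) = cosh (a + b) + sinh (a + b)" by (rule cosh_plus_sinh[symmetric])
  ultimately show ?thesis using pos by (simp only:) (simp add: field_simps)
qed

text \<open>Only the edges starting at \<open>i\<close> and at its predecessor see the spin at
  \<open>i\<close>; \<open>R\<close> collects all others and does not depend on
  \<open>c\<close>.\<close>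

lemma boltzmann_split:
  assumes n: "n \<ge> 2" and i: "i \<in> {1..n}"
  obtains R where
    "\<And>c. boltzmann_weight n J (\<sigma>(i := c))
       = exp R * exp (c * (J (cyc_pred n i) * \<sigma> (cyc_pred n i) + J i * \<sigma> (cyc_succ n i)))"
proof
  let ?R = "\<Sum>j\<in>{1..n} - {i, cyc_pred n i}. J j * \<sigma> j * \<sigma> (cyc_succ n j)"
  fix c
  let ?t = "\<sigma>(i := c)"
  have sub: "{i, cyc_pred n i} \<subseteq> {1..n}" using i cyc_pred_in[OF i] by simp
  have "(\<Sum>j=1..n. J j * ?t j * ?t (cyc_succ n j))
      = (\<Sum>j\<in>{1..n} - {i, cyc_pred n i}. J j * ?t j * ?t (cyc_succ n j))
      + (\<Sum>j\<in>{i, cyc_pred n i}. J j * ?t j * ?t (cyc_succ n j))"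
    by (rule sum.subset_diff[OF sub]) simp
  also have "(\<Sum>j\<in>{1..n} - {i, cyc_pred n i}. J j * ?t j * ?t (cyc_succ n j)) = ?R"
  proof (rule sum.cong)
    fix j assume j: "j \<in> {1..n} - {i, cyc_pred n i}"
    then have "cyc_succ n j \<noteq> i" using cyc_pred_succ[of j n] by auto
    with j show "J j * ?t j * ?t (cyc_succ n j) = J j * \<sigma> j * \<sigma> (cyc_succ n j)" by simp
  qed simp
  also have "(\<Sum>j\<in>{i, cyc_pred n i}. J j * ?t j * ?t (cyc_succ n j))
      = c * (J (cyc_pred n i) * \<sigma> (cyc_pred n i) + J i * \<sigma> (cyc_succ n i))"
    using cyc_pred_neq[OF n i] cyc_succ_neq[OF n i]
    by (simp add: cyc_succ_pred[OF i] eq_commute[of i] algebra_simps)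
  finally show "boltzmann_weight n J ?t
      = exp ?R * exp (c * (J (cyc_pred n i) * \<sigma> (cyc_pred n i) + J i * \<sigma> (cyc_succ n i)))"
    by (simp add: boltzmann_weight_def exp_add)
qed

lemma partition_function_pos: "partition_function n J > 0"
proof -
  have "configs n \<noteq> {}" by (auto simp: configs_def PiE_eq_empty_iff)
  then show ?thesis
    unfolding partition_function_def by (intro sum_pos finite_configs) (auto simp: boltzmann_weight_def)
qed

text \<open>The partition function and \<open>exp R\<close> cancel. The spins are absorbed into
  signed couplings \<open>a\<close> and \<open>b\<close>; as spins are signs, they come out of
  \<open>sinh\<close> as factors and disappear from \<open>cosh\<close>.\<close>

lemma flip_prob_eq:
  fixes J :: "nat \<Rightarrow> real"
  assumes n: "n \<ge> 2" and i: "i \<in> {1..n}" and \<sigma>: "\<sigma> \<in> configs n"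
  defines "s \<equiv> \<lambda>i. sinh (2 * J i)"
  shows "flip_prob n J \<sigma> i = (1 - \<sigma> i * cyc_adj n s \<sigma> i / cyc_deg n s i) / 2 / real n"
proof -
  let ?p = "cyc_pred n i" and ?q = "cyc_succ n i"
  obtain R where R: "\<And>c. boltzmann_weight n J (\<sigma>(i := c)) = exp R * exp (c * (J ?p * \<sigma> ?p + J i * \<sigma> ?q))"
    using boltzmann_split[OF n i] by metis
  define a where "a = J ?p * \<sigma> ?p * \<sigma> i"
  define b where "b = J i * \<sigma> ?q * \<sigma> i"
  have w: "boltzmann_weight n J \<sigma> = exp R * exp (a + b)"
    using R[of "\<sigma> i"] by (simp add: a_def b_def algebra_simps)
  have w': "boltzmann_weight n J (flip_spin i \<sigma>) = exp R * exp (- (a + b))"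
    using R[of "- \<sigma> i"] by (simp add: flip_spin_def a_def b_def algebra_simps)
  have "gibbs n J (flip_spin i \<sigma>) / (gibbs n J \<sigma> + gibbs n J (flip_spin i \<sigma>))
      = boltzmann_weight n J (flip_spin i \<sigma>) / (boltzmann_weight n J \<sigma> + boltzmann_weight n J (flip_spin i \<sigma>))"
    using partition_function_pos[of n J] by (simp add: gibbs_def add_divide_distrib[symmetric])
  also have "\<dots> = exp (- (a + b)) / (exp (a + b) + exp (- (a + b)))"
    unfolding w w' distrib_left[symmetric] by simp
  also have "\<dots> = (1 - (sinh (2 * a) + sinh (2 * b)) / (cosh (2 * a) + cosh (2 * b))) / 2"
    by (rule heat_bath_ratio)
  also have "sinh (2 * a) + sinh (2 * b) = \<sigma> i * cyc_adj n s \<sigma> i"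
    using config_cases[OF \<sigma> i] config_cases[OF \<sigma> cyc_pred_in[OF i]] config_cases[OF \<sigma> cyc_succ_in[OF i]]
    by (auto simp: a_def b_def cyc_adj_def s_def)
  also have "cosh (2 * a) + cosh (2 * b) = cyc_deg n s i"
    using config_cases[OF \<sigma> i] config_cases[OF \<sigma> cyc_pred_in[OF i]] config_cases[OF \<sigma> cyc_succ_in[OF i]]
    by (auto simp: a_def b_def cyc_deg_def s_def edge_cosh_sinh)
  finally show ?thesis unfolding flip_prob_def by (simp only:) simp
qed

lemma sum_glauber:
  assumes \<sigma>: "\<sigma> \<in> configs n"
  shows "(\<Sum>\<tau>\<in>configs n. glauber n J \<sigma> \<tau> * f \<tau>)
     = f \<sigma> + (\<Sum>i=1..n. flip_prob n J \<sigma> i * (f (flip_spin i \<sigma>) - f \<sigma>))"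
proof -
  have "(\<Sum>\<tau>\<in>configs n. glauber n J \<sigma> \<tau> * f \<tau>)
      = glauber n J \<sigma> \<sigma> * f \<sigma> + (\<Sum>\<tau>\<in>configs n - {\<sigma>}. glauber n J \<sigma> \<tau> * f \<tau>)"
    by (rule sum.remove[OF finite_configs \<sigma>])
  also have "(\<Sum>\<tau>\<in>configs n - {\<sigma>}. glauber n J \<sigma> \<tau> * f \<tau>)
      = (\<Sum>\<tau>\<in>configs n - {\<sigma>}. \<Sum>i=1..n. if \<tau> = flip_spin i \<sigma> then flip_prob n J \<sigma> i * f \<tau> else 0)"
    by (rule sum.cong) (auto simp: glauber_def sum_distrib_right intro!: sum.cong)
  also have "\<dots> = (\<Sum>i=1..n. \<Sum>\<tau>\<in>configs n - {\<sigma>}. if \<tau> = flip_spin i \<sigma> then flip_prob n J \<sigma> i * f \<tau> else 0)"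
    by (rule sum.swap)
  also have "\<dots> = (\<Sum>i=1..n. flip_prob n J \<sigma> i * f (flip_spin i \<sigma>))"
  proof (rule sum.cong)
    fix i assume "i \<in> {1..n}"
    then have "flip_spin i \<sigma> \<in> configs n - {\<sigma>}" using flip_in_configs flip_neq \<sigma> by auto
    then show "(\<Sum>\<tau>\<in>configs n - {\<sigma>}. if \<tau> = flip_spin i \<sigma> then flip_prob n J \<sigma> i * f \<tau> else 0)
        = flip_prob n J \<sigma> i * f (flip_spin i \<sigma>)"
      by (subst sum.delta) (auto simp: finite_configs)
  qed simp
  finally show ?thesis
    by (simp add: glauber_def algebra_simps sum_subtractf sum_distrib_left sum_distrib_right)
qed

text \<open>Of the two outcomes of resampling at \<open>i\<close>, one is \<open>\<sigma>\<close>
  and the other its flip, so each update contributes \<open>f \<sigma>\<close> plus a weighted flip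
  difference.\<close>

lemma sum_glauber_heat_bath:
  assumes n: "n \<ge> 2" and \<sigma>: "\<sigma> \<in> configs n"
  shows "(\<Sum>\<tau>\<in>configs n. glauber n J \<sigma> \<tau> * f \<tau>) = heat_bath_avg n (\<lambda>i. sinh (2 * J i)) f \<sigma>"
proof -
  let ?s = "\<lambda>i. sinh (2 * J i)"
  have "heat_bath n ?s i f \<sigma> / real n
      = f \<sigma> / real n + flip_prob n J \<sigma> i * (f (flip_spin i \<sigma>) - f \<sigma>)" if i: "i \<in> {1..n}" for i
  proof -
    define m where "m = cyc_adj n ?s \<sigma> i / cyc_deg n ?s i"
    have p: "flip_prob n J \<sigma> i = (1 - \<sigma> i * m) / 2 / real n"
      using flip_prob_eq[OF n i \<sigma>, of J] by (simp add: m_def)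
    have h: "heat_bath n ?s i f \<sigma> = (1 + m) / 2 * f (\<sigma>(i := 1)) + (1 - m) / 2 * f (\<sigma>(i := - 1))"
      by (simp add: heat_bath_def m_def)
    from config_cases[OF \<sigma> i] show ?thesis
    proof
      assume "\<sigma> i = 1"
      moreover from this have "\<sigma>(i := 1) = \<sigma>" by auto
      ultimately show ?thesis using n unfolding p h by (simp add: flip_spin_def field_simps)
    next
      assume "\<sigma> i = - 1"
      moreover from this have "\<sigma>(i := - 1) = \<sigma>" by auto
      ultimately show ?thesis using n unfolding p h by (simp add: flip_spin_def field_simps)
    qed
  qed
  then have "heat_bath_avg n ?s f \<sigma>
      = (\<Sum>i=1..n. f \<sigma> / real n + flip_prob n J \<sigma> i * (f (flip_spin i \<sigma>) - f \<sigma>))"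
    unfolding heat_bath_avg_def sum_divide_distrib by (intro sum.cong) auto
  then show ?thesis using n by (simp add: sum_glauber[OF \<sigma>] sum.distrib)
qed

section \<open>Path coupling and linear eigenfunctions\<close>

text \<open>A disagreement at \<open>i\<close> has two effects. It survives the update at
  \<open>j\<close> unless \<open>j = i\<close>, at cost \<open>w i\<close>; and it shifts the mean
  at a neighbour \<open>j\<close>, at cost \<open>w j\<close> times a bound on the change of the
  update probability.\<close>

lemma heat_bath_flip_diff:
  assumes n: "n \<ge> 2" and s: "\<And>i. i \<in> {1..n} \<Longrightarrow> s i > 0"
    and lip: "\<And>\<sigma> i. \<sigma> \<in> configs n \<Longrightarrow> i \<in> {1..n} \<Longrightarrow> \<bar>f (flip_spin i \<sigma>) - f \<sigma>\<bar> \<le> w i"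
    and \<sigma>: "\<sigma> \<in> configs n" and i: "i \<in> {1..n}" and j: "j \<in> {1..n}"
  shows "\<bar>heat_bath n s j f (flip_spin i \<sigma>) - heat_bath n s j f \<sigma>\<bar>
     \<le> (if j = i then 0 else w i) + w j / cyc_deg n s j * cyc_adj n s (\<lambda>k. if k = i then 1 else 0) j"
proof -
  let ?e = "\<lambda>k. if k = i then 1 else 0 :: real" and ?\<sigma>' = "flip_spin i \<sigma>" and ?d = "cyc_deg n s j"
  have d: "?d > 0" using cyc_deg_ge[of n s j] by simp
  have wj: "w j \<ge> 0" using lip[OF \<sigma> j] by linarith
  have e: "cyc_adj n s ?e j \<ge> 0"
    using s[OF j] s[OF cyc_pred_in[OF j]] by (simp add: cyc_adj_def)
  show ?thesis
  proof (cases "j = i")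
    case True
    have "heat_bath n s j f ?\<sigma>' = heat_bath n s j f \<sigma>"
      using True cyc_adj_upd_self[OF n i] by (simp add: heat_bath_def flip_spin_def)
    then show ?thesis using True d wj e by simp
  next
    case False
    define m where "m = cyc_adj n s \<sigma> j / ?d"
    define m' where "m' = cyc_adj n s ?\<sigma>' j / ?d"
    define a b a' b' where "a = f (\<sigma>(j := 1))" "b = f (\<sigma>(j := - 1))"
      "a' = f (?\<sigma>'(j := 1))" "b' = f (?\<sigma>'(j := - 1))"
    have m: "\<bar>m\<bar> \<le> 1" using abs_cyc_adj_le[OF s \<sigma> j] d by (simp add: m_def)
    have com: "?\<sigma>'(j := c) = flip_spin i (\<sigma>(j := c))" for c
      using False by (simp add: flip_spin_def fun_upd_twist)
    have aa: "\<bar>a' - a\<bar> \<le> w i" and bb: "\<bar>b' - b\<bar> \<le> w i"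
      unfolding a_b_a'_b'_def com using config_upd[OF \<sigma> j] by (intro lip i; simp)+
    have "flip_spin j (?\<sigma>'(j := 1)) = ?\<sigma>'(j := - 1)" by (simp add: flip_spin_def)
    then have ab: "\<bar>a' - b'\<bar> \<le> w j"
      using lip[OF config_upd[OF flip_in_configs[OF \<sigma> i] j, of 1] j]
      by (simp add: a_b_a'_b'_def abs_minus_commute)
    have spin: "\<bar>?\<sigma>' k - \<sigma> k\<bar> = 2 * ?e k" for k
      using config_cases[OF \<sigma> i] by (auto simp: flip_spin_def)
    have "\<bar>cyc_adj n s ?\<sigma>' j - cyc_adj n s \<sigma> j\<bar>
        = \<bar>s (cyc_pred n j) * (?\<sigma>' (cyc_pred n j) - \<sigma> (cyc_pred n j))
           + s j * (?\<sigma>' (cyc_succ n j) - \<sigma> (cyc_succ n j))\<bar>"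
      by (simp add: cyc_adj_def algebra_simps)
    also have "\<dots> \<le> \<bar>s (cyc_pred n j) * (?\<sigma>' (cyc_pred n j) - \<sigma> (cyc_pred n j))\<bar>
           + \<bar>s j * (?\<sigma>' (cyc_succ n j) - \<sigma> (cyc_succ n j))\<bar>"
      by (rule abs_triangle_ineq)
    also have "\<dots> = 2 * cyc_adj n s ?e j"
      unfolding abs_mult spin cyc_adj_def using s[OF j] s[OF cyc_pred_in[OF j]] by simp
    finally have "\<bar>m' - m\<bar> \<le> 2 * cyc_adj n s ?e j / ?d"
      using d by (simp add: m_def m'_def diff_divide_distrib[symmetric] divide_right_mono)
    then have mm: "\<bar>(m' - m) / 2\<bar> \<le> cyc_adj n s ?e j / ?d" by (simp add: mult.commute)
    \<comment> \<open>The first two terms carry the disagreement at \<open>i\<close>, the third the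
      changed update probability at \<open>j\<close>.\<close>
    have "heat_bath n s j f ?\<sigma>' - heat_bath n s j f \<sigma>
        = (1 + m) / 2 * (a' - a) + (1 - m) / 2 * (b' - b) + (m' - m) / 2 * (a' - b')"
      by (simp add: heat_bath_def m_def[symmetric] m'_def[symmetric] a_b_a'_b'_def[symmetric] field_simps)
    also have "\<bar>\<dots>\<bar> \<le> \<bar>(1 + m) / 2 * (a' - a)\<bar> + \<bar>(1 - m) / 2 * (b' - b)\<bar> + \<bar>(m' - m) / 2 * (a' - b')\<bar>"
      by linarith
    also have "\<dots> \<le> (1 + m) / 2 * w i + (1 - m) / 2 * w i + cyc_adj n s ?e j / ?d * w j"
      unfolding abs_mult using m aa bb ab mm e d by (intro add_mono mult_mono) auto
    also have "\<dots> = w i + w j / ?d * cyc_adj n s ?e j" by (simp add: field_simps)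
    finally show ?thesis using False by simp
  qed
qed

text \<open>Path coupling with the weights \<open>cyc_deg n s i * x i\<close>, the left Perron vector of the
  linearized dynamics.\<close>

lemma heat_bath_avg_contraction:
  assumes n: "n \<ge> 2" and s: "\<And>i. i \<in> {1..n} \<Longrightarrow> s i > 0" and x: "perron_pair n s x l"
    and lip: "\<And>\<sigma> i. \<sigma> \<in> configs n \<Longrightarrow> i \<in> {1..n}
      \<Longrightarrow> \<bar>f (flip_spin i \<sigma>) - f \<sigma>\<bar> \<le> K * (cyc_deg n s i * x i)"
    and \<sigma>: "\<sigma> \<in> configs n" and i: "i \<in> {1..n}"
  shows "\<bar>heat_bath_avg n s f (flip_spin i \<sigma>) - heat_bath_avg n s f \<sigma>\<bar>
     \<le> (1 - (1 - l) / real n) * (K * (cyc_deg n s i * x i))"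
proof -
  let ?e = "\<lambda>k. if k = i then 1 else 0 :: real"
  define w where "w j = K * (cyc_deg n s j * x j)" for j
  have "\<bar>(\<Sum>j=1..n. heat_bath n s j f (flip_spin i \<sigma>)) - (\<Sum>j=1..n. heat_bath n s j f \<sigma>)\<bar>
      \<le> (\<Sum>j=1..n. \<bar>heat_bath n s j f (flip_spin i \<sigma>) - heat_bath n s j f \<sigma>\<bar>)"
    unfolding sum_subtractf[symmetric] by (rule sum_abs)
  also have "\<dots> \<le> (\<Sum>j=1..n. (if j = i then 0 else w i) + w j / cyc_deg n s j * cyc_adj n s ?e j)"
    using lip by (intro sum_mono heat_bath_flip_diff n s \<sigma> i) (auto simp: w_def)
  also have "\<dots> = (\<Sum>j=1..n. w i - (if j = i then w i else 0)) + K * (\<Sum>j=1..n. x j * cyc_adj n s ?e j)"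
    unfolding sum_distrib_left sum.distrib[symmetric]
  proof (rule sum.cong)
    fix j
    show "(if j = i then 0 else w i) + w j / cyc_deg n s j * cyc_adj n s ?e j
        = w i - (if j = i then w i else 0) + K * (x j * cyc_adj n s ?e j)"
      using cyc_deg_ge[of n s j] by (simp add: w_def)
  qed simp
  \<comment> \<open>Self-adjointness moves \<open>cyc_adj\<close> onto \<open>x\<close>, where the
    eigenvalue equation applies.\<close>
  also have "(\<Sum>j=1..n. x j * cyc_adj n s ?e j) = (\<Sum>j=1..n. ?e j * cyc_adj n s x j)"
    by (rule sum_cyc_adj_commute)
  also have "\<dots> = (\<Sum>j=1..n. if j = i then cyc_adj n s x j else 0)"
    by (rule sum.cong) auto
  also have "\<dots> = cyc_adj n s x i"
    using i by (subst sum.delta) auto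
  also have "K * cyc_adj n s x i = l * w i"
    using x i by (simp add: perron_pair_def w_def)
  also have "(\<Sum>j=1..n. w i - (if j = i then w i else 0)) = real n * w i - w i"
    using i by (simp add: sum_subtractf)
  finally have "\<bar>(\<Sum>j=1..n. heat_bath n s j f (flip_spin i \<sigma>)) - (\<Sum>j=1..n. heat_bath n s j f \<sigma>)\<bar>
      \<le> real n * w i - w i + l * w i" .
  then show ?thesis
    using n unfolding heat_bath_avg_def w_def[symmetric] diff_divide_distrib[symmetric]
    by (simp add: field_simps)
qed

lemma flip_invariant_imp_constant:
  assumes inv: "\<And>\<sigma> i. \<sigma> \<in> configs n \<Longrightarrow> i \<in> {1..n} \<Longrightarrow> f (flip_spin i \<sigma>) = f \<sigma>"
    and \<sigma>: "\<sigma> \<in> configs n" and \<tau>: "\<tau> \<in> configs n"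
  shows "f \<sigma> = f \<tau>"
proof -
  \<comment> \<open>Interpolation changing one vertex at a time. Index 0 is not a vertex and all
    configurations agree there, so \<open>h 0 = \<sigma>\<close>.\<close>
  define h where "h k = (\<lambda>i. if i \<le> k then \<tau> i else \<sigma> i)" for k
  have h0: "h 0 = \<sigma>"
    using \<sigma> \<tau> by (auto simp: h_def configs_def PiE_iff extensional_def fun_eq_iff)
  have hn: "h n = \<tau>"
    using \<sigma> \<tau> by (auto simp: h_def configs_def PiE_iff extensional_def fun_eq_iff)
  have mem: "h k \<in> configs n" for k
    using \<sigma> \<tau> by (auto simp: h_def configs_def PiE_iff extensional_def)
  have "k \<le> n \<Longrightarrow> f (h k) = f \<sigma>" for k
  proof (induction k)
    case (Suc k)
    then have i: "Suc k \<in> {1..n}" by simp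
    have upd: "h (Suc k) = (h k)(Suc k := \<tau> (Suc k))"
      by (auto simp: h_def fun_eq_iff le_Suc_eq)
    have "f (h (Suc k)) = f (h k)"
    proof (cases "\<tau> (Suc k) = \<sigma> (Suc k)")
      case True
      then have "h (Suc k) = h k" unfolding upd by (auto simp: h_def fun_eq_iff)
      then show ?thesis by simp
    next
      case False
      then have "\<tau> (Suc k) = - h k (Suc k)"
        using config_cases[OF \<sigma> i] config_cases[OF \<tau> i] by (auto simp: h_def)
      then have "h (Suc k) = flip_spin (Suc k) (h k)" unfolding upd flip_spin_def by simp
      then show ?thesis using inv[OF mem i] by simp
    qed
    with Suc show ?case by simp
  qed (simp add: h0)
  from this[of n] show ?thesis by (simp add: hn)
qed

text \<open>\<open>K\<close> is the best Lipschitz constant of \<open>f\<close> for the weights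
  \<open>w\<close>, positive as \<open>f\<close> is not constant. The contraction is applied where
  \<open>K\<close> is attained; \<open>c\<close> cancels in flip differences, so eigenfunctions
  modulo constants are covered.\<close>

lemma eigenvalue_modulo_constants_le:
  assumes n: "n \<ge> 2" and s: "\<And>i. i \<in> {1..n} \<Longrightarrow> s i > 0" and x: "perron_pair n s x l"
    and eig: "\<And>\<sigma>. \<sigma> \<in> configs n \<Longrightarrow> heat_bath_avg n s f \<sigma> = \<nu> * f \<sigma> + c"
    and nonconst: "\<sigma>0 \<in> configs n" "\<tau>0 \<in> configs n" "f \<sigma>0 \<noteq> f \<tau>0"
  shows "\<nu> \<le> 1 - (1 - l) / real n"
proof -
  define w where "w i = cyc_deg n s i * x i" for i
  have w: "w i > 0" if "i \<in> {1..n}" for i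
    using x that cyc_deg_ge[of n s i] by (simp add: w_def perron_pair_def)
  define q where "q = (\<lambda>(\<sigma>, i). \<bar>f (flip_spin i \<sigma>) - f \<sigma>\<bar> / w i)"
  let ?D = "configs n \<times> {1..n}"
  have fin: "finite (q ` ?D)" by (simp add: finite_configs)
  have ne: "q ` ?D \<noteq> {}" using nonconst(1) n by auto
  define K where "K = Max (q ` ?D)"
  have "K \<in> q ` ?D" unfolding K_def by (rule Max_in[OF fin ne])
  then obtain \<sigma> i where \<sigma>: "\<sigma> \<in> configs n" and i: "i \<in> {1..n}" and K: "K = \<bar>f (flip_spin i \<sigma>) - f \<sigma>\<bar> / w i"
    by (auto simp: q_def)
  have lip: "\<bar>f (flip_spin j \<tau>) - f \<tau>\<bar> \<le> K * w j" if "\<tau> \<in> configs n" "j \<in> {1..n}" for \<tau> j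
  proof -
    have "q (\<tau>, j) \<le> K" unfolding K_def using that by (intro Max_ge fin) auto
    then show ?thesis using w[OF that(2)] by (simp add: q_def field_simps)
  qed
  have "K > 0"
  proof (rule ccontr)
    assume "\<not> K > 0"
    moreover have "K \<ge> 0" using K w[OF i] by simp
    ultimately have "f (flip_spin j \<tau>) = f \<tau>" if "\<tau> \<in> configs n" "j \<in> {1..n}" for \<tau> j
      using lip[OF that] by simp
    from flip_invariant_imp_constant[OF this nonconst(1,2)] nonconst(3) show False by simp
  qed
  then have Kw: "K * w i > 0" using w[OF i] by simp
  have Kw_eq: "\<bar>f (flip_spin i \<sigma>) - f \<sigma>\<bar> = K * w i" using K w[OF i] by simp
  have "heat_bath_avg n s f (flip_spin i \<sigma>) - heat_bath_avg n s f \<sigma> = \<nu> * (f (flip_spin i \<sigma>) - f \<sigma>)"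
    using eig[OF \<sigma>] eig[OF flip_in_configs[OF \<sigma> i]] by (simp add: algebra_simps)
  then have "\<bar>\<nu>\<bar> * (K * w i) \<le> (1 - (1 - l) / real n) * (K * w i)"
    using heat_bath_avg_contraction[OF n s x lip[unfolded w_def] \<sigma> i] Kw_eq
    by (simp add: abs_mult w_def)
  then have "\<bar>\<nu>\<bar> \<le> 1 - (1 - l) / real n"
    by (rule mult_right_le_imp_le[OF _ Kw])
  then show ?thesis by linarith
qed

text \<open>The coefficient \<open>cyc_deg\<close> cancels the denominator of the conditional mean,
  after which self-adjointness lets \<open>cyc_adj\<close> act on \<open>x\<close>.\<close>

lemma heat_bath_avg_linear:
  assumes n: "n \<ge> 2" and s: "\<And>i. i \<in> {1..n} \<Longrightarrow> s i > 0" and x: "perron_pair n s x l"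
    and \<sigma>: "\<sigma> \<in> configs n"
  defines "f \<equiv> \<lambda>\<sigma>. \<Sum>i=1..n. cyc_deg n s i * x i * \<sigma> i"
  shows "heat_bath_avg n s f \<sigma> = (1 - (1 - l) / real n) * f \<sigma>"
proof -
  have upd: "f (\<sigma>(i := c)) = f \<sigma> + cyc_deg n s i * x i * (c - \<sigma> i)" if i: "i \<in> {1..n}" for i c
  proof -
    have "f (\<sigma>(i := c)) = (\<Sum>j=1..n. cyc_deg n s j * x j * \<sigma> j + (if j = i then cyc_deg n s i * x i * (c - \<sigma> i) else 0))"
      unfolding f_def by (rule sum.cong) (auto simp: algebra_simps)
    then show ?thesis using i by (simp add: sum.distrib f_def)
  qed
  have "heat_bath n s i f \<sigma> = f \<sigma> + (x i * cyc_adj n s \<sigma> i - cyc_deg n s i * x i * \<sigma> i)"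
    if i: "i \<in> {1..n}" for i
    using cyc_deg_ge[of n s i] unfolding heat_bath_def upd[OF i] by (simp add: field_simps)
  then have "(\<Sum>i=1..n. heat_bath n s i f \<sigma>)
      = (\<Sum>i=1..n. f \<sigma> + (x i * cyc_adj n s \<sigma> i - cyc_deg n s i * x i * \<sigma> i))"
    by (intro sum.cong) auto
  also have "\<dots> = real n * f \<sigma> + ((\<Sum>i=1..n. x i * cyc_adj n s \<sigma> i) - f \<sigma>)"
    by (simp add: sum.distrib sum_subtractf f_def)
  also have "(\<Sum>i=1..n. x i * cyc_adj n s \<sigma> i) = (\<Sum>i=1..n. \<sigma> i * cyc_adj n s x i)"
    by (rule sum_cyc_adj_commute)
  also have "\<dots> = l * f \<sigma>"
    unfolding f_def sum_distrib_left by (rule sum.cong) (use x in \<open>auto simp: perron_pair_def\<close>)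
  finally show ?thesis using n by (simp add: heat_bath_avg_def field_simps)
qed

subsection \<open>The second eigenvalue\<close>

text \<open>\<open>q\<close> is the characteristic polynomial of the map induced by \<open>A\<close> on the quotient by the constants.\<close>

lemma char_poly_row_sums_one:
  fixes A :: "'a :: field mat"
  assumes A: "A \<in> carrier_mat (Suc m) (Suc m)"
    and rows: "\<And>i. i < Suc m \<Longrightarrow> (\<Sum>j<Suc m. A $$ (i, j)) = 1"
  shows "\<exists>q. q \<noteq> 0 \<and> char_poly A = [:- 1, 1:] * q \<and>
    (\<forall>\<nu>. poly q \<nu> = 0 \<longrightarrow>
      (\<exists>g c. (\<forall>i<Suc m. (\<Sum>j<Suc m. A $$ (i, j) * g j) = \<nu> * g i + c)
         \<and> (\<exists>i<Suc m. g i \<noteq> g 0)))"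
proof -
  let ?N = "Suc m"
  \<comment> \<open>Subtracting the entry at index 0 gives coordinates on the quotient;
    \<open>B\<close> is the induced map in these coordinates.\<close>
  define B where "B = mat m m (\<lambda>(i, j). A $$ (Suc i, Suc j) - A $$ (0, Suc j))"
  define R where "R = mat 1 m (\<lambda>(i, j). A $$ (0, Suc j))"
  define T where "T = four_block_mat (1\<^sub>m 1) R (0\<^sub>m m 1) B"
  \<comment> \<open>The columns of \<open>P\<close> are the all-ones vector and the unit vectors
    other than the first; \<open>Q\<close> is its inverse. Since the rows of \<open>A\<close> sum to
    1, this basis turns \<open>A\<close> into the block triangular \<open>T\<close>.\<close>
  define P where "P = mat ?N ?N (\<lambda>(i, j). if j = 0 \<or> i = j then 1 else 0 :: 'a)"
  define Q where "Q = mat ?N ?N (\<lambda>(i, j). if i = j then 1 else if j = 0 then - 1 else 0 :: 'a)"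
  have B: "B \<in> carrier_mat m m" and R: "R \<in> carrier_mat 1 m" and P: "P \<in> carrier_mat ?N ?N"
    and Q: "Q \<in> carrier_mat ?N ?N"
    by (auto simp: B_def R_def P_def Q_def)
  have T: "T \<in> carrier_mat ?N ?N" using B R by (auto simp: T_def)
  have T_entry: "T $$ (i, j) = (if i = 0 then if j = 0 then 1 else A $$ (0, j)
      else if j = 0 then 0 else A $$ (i, j) - A $$ (0, j))" if "i < ?N" "j < ?N" for i j
    using that B R by (cases i; cases j) (auto simp: T_def B_def R_def)
  have P_mult: "(P * X) $$ (i, j) = (if i = 0 then X $$ (0, j) else X $$ (0, j) + X $$ (i, j))"
    if X: "X \<in> carrier_mat ?N ?N" and i: "i < ?N" and j: "j < ?N" for X i j
  proof -
    have "(P * X) $$ (i, j) = (\<Sum>k<?N. (if k = 0 \<or> i = k then 1 else 0) * X $$ (k, j))"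
      using X i j by (simp add: P_def scalar_prod_def atLeast0LessThan)
    also have "\<dots> = (\<Sum>k<?N. (if k = 0 then X $$ (0, j) else 0)
        + (if k = i then if i = 0 then 0 else X $$ (i, j) else 0))"
      by (rule sum.cong) auto
    also have "\<dots> = (if i = 0 then X $$ (0, j) else X $$ (0, j) + X $$ (i, j))"
      using i unfolding sum.distrib by (simp add: sum.delta del: sum.lessThan_Suc)
    finally show ?thesis .
  qed
  have PQ: "P * Q = 1\<^sub>m ?N"
    by (rule eq_matI) (use P Q in \<open>auto simp: P_mult[OF Q] simp del: index_mult_mat(1)\<close>, auto simp: Q_def)
  have QP: "Q * P = 1\<^sub>m ?N" by (rule mat_mult_left_right_inverse[OF P Q PQ])
  have AP: "A * P = P * T"
  proof (rule eq_matI)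
    fix i j assume "i < dim_row (P * T)" "j < dim_col (P * T)"
    then have i: "i < ?N" and j: "j < ?N" using P T by auto
    have "(A * P) $$ (i, j) = (\<Sum>k<?N. A $$ (i, k) * (if j = 0 \<or> k = j then 1 else 0))"
      using A i j by (simp add: P_def scalar_prod_def atLeast0LessThan del: sum.lessThan_Suc)
    also have "\<dots> = (if j = 0 then 1 else A $$ (i, j))"
    proof (cases "j = 0")
      case True
      then show ?thesis using rows[OF i] by (simp del: sum.lessThan_Suc)
    next
      case False
      then have "(\<Sum>k<?N. A $$ (i, k) * (if j = 0 \<or> k = j then 1 else 0)) = (\<Sum>k<?N. if k = j then A $$ (i, k) else 0)"
        by (intro sum.cong) auto
      then show ?thesis using False j by (simp add: sum.delta del: sum.lessThan_Suc)
    qed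
    also have "\<dots> = (P * T) $$ (i, j)"
      unfolding P_mult[OF T i j] using i j by (auto simp: T_entry)
    finally show "(A * P) $$ (i, j) = (P * T) $$ (i, j)" .
  qed (use A P T in auto)
  have "A = A * (P * Q)" using A PQ by simp
  also have "\<dots> = P * T * Q" using A P Q by (simp add: AP flip: assoc_mult_mat)
  finally have "A = P * T * Q" .
  then have "similar_mat A T"
    by (intro similar_matI[OF _ PQ QP]) (use A P Q T in simp_all)
  then have "char_poly A = char_poly T" by (rule char_poly_similar)
  also have "\<dots> = char_poly (1\<^sub>m 1 :: 'a mat) * char_poly B"
    unfolding T_def by (rule char_poly_four_block_zeros_col[OF _ R B]) simp
  also have "char_poly (1\<^sub>m 1 :: 'a mat) = [:- 1, 1:]"
    by (simp add: char_poly_def char_poly_matrix_def det_single)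
  finally have factor: "char_poly A = [:- 1, 1:] * char_poly B" .
  have nonzero: "char_poly B \<noteq> 0" using degree_monic_char_poly[OF B] by auto
  have "\<exists>g c. (\<forall>i<?N. (\<Sum>j<?N. A $$ (i, j) * g j) = \<nu> * g i + c) \<and> (\<exists>i<?N. g i \<noteq> g 0)"
    if "poly (char_poly B) \<nu> = 0" for \<nu>
  proof -
    from that obtain v where "eigenvector B v \<nu>"
      using eigenvalue_root_char_poly[OF B] by (auto simp: eigenvalue_def)
    then have v: "v \<in> carrier_vec m" "v \<noteq> 0\<^sub>v m" "B *\<^sub>v v = \<nu> \<cdot>\<^sub>v v"
      using B by (auto simp: eigenvector_def)
    \<comment> \<open>\<open>g\<close> is the representative of \<open>v\<close> that vanishes at
      index 0, and \<open>c\<close> is the value of its image there.\<close>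
    define g where "g i = (case i of 0 \<Rightarrow> 0 | Suc k \<Rightarrow> v $ k)" for i
    define c where "c = (\<Sum>j<m. A $$ (0, Suc j) * v $ j)"
    have sum_g: "(\<Sum>j<?N. A $$ (i, j) * g j) = (\<Sum>j<m. A $$ (i, Suc j) * v $ j)" for i
      unfolding sum.lessThan_Suc_shift by (simp add: g_def)
    have "(\<Sum>j<?N. A $$ (i, j) * g j) = \<nu> * g i + c" if i: "i < ?N" for i
    proof (cases i)
      case 0
      then show ?thesis unfolding sum_g by (simp add: g_def c_def)
    next
      case (Suc k)
      then have k: "k < m" using i by simp
      have "\<nu> * v $ k = (B *\<^sub>v v) $ k" using v k by simp
      also have "\<dots> = (\<Sum>j<m. (A $$ (i, Suc j) - A $$ (0, Suc j)) * v $ j)"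
        using v(1) k Suc by (simp add: B_def scalar_prod_def atLeast0LessThan)
      also have "\<dots> = (\<Sum>j<m. A $$ (i, Suc j) * v $ j) - c"
        by (simp add: c_def left_diff_distrib sum_subtractf)
      finally show ?thesis unfolding sum_g using Suc by (simp add: g_def)
    qed
    moreover have "\<exists>i<?N. g i \<noteq> g 0"
    proof -
      obtain k where "k < m" "v $ k \<noteq> 0" using v(1,2) by (metis carrier_vecD eq_vecI index_zero_vec(1,2))
      then show ?thesis by (intro exI[of _ "Suc k"]) (simp add: g_def)
    qed
    ultimately show ?thesis by blast
  qed
  then show ?thesis using factor nonzero by blast
qed

text \<open>The ascending list ends in \<open>b\<close>, \<open>a\<close>; after reversal
  \<open>b\<close> has index 1, the one that \<open>mu\<close> reads for
  \<open>k = 2\<close>.\<close>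

lemma sorted_list_of_multiset_second_largest:
  assumes "M = {#a, b#} + R" "b \<le> a" "\<And>c. c \<in># R \<Longrightarrow> c \<le> b"
  shows "rev (sorted_list_of_multiset M) ! 1 = b"
proof -
  have "sorted (sorted_list_of_multiset R @ [b, a])"
    using assms(2,3) by (auto simp: sorted_append dest: order.trans)
  moreover have "M = mset (sorted_list_of_multiset R @ [b, a])"
    using assms(1) by simp
  ultimately have "sorted_list_of_multiset M = sorted_list_of_multiset R @ [b, a]"
    by (metis sorted_list_of_multiset_mset sorted_sort_id)
  then show ?thesis by simp
qed

section \<open>From the spectrum to the relaxation time\<close>

lemma glauber_matrix_carrier: "glauber_matrix n J \<in> carrier_mat (2 ^ n) (2 ^ n)"
  by (simp add: glauber_matrix_def)

lemma sum_glauber_matrix: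
  assumes "k < 2 ^ n"
  shows "(\<Sum>j<2 ^ n. glauber_matrix n J $$ (k, j) * f (nth_config n j))
     = (\<Sum>\<tau>\<in>configs n. glauber n J (nth_config n k) \<tau> * f \<tau>)"
proof -
  have "(\<Sum>j<2 ^ n. glauber_matrix n J $$ (k, j) * f (nth_config n j))
      = (\<Sum>j<2 ^ n. glauber n J (nth_config n k) (nth_config n j) * f (nth_config n j))"
    using assms by (intro sum.cong) (auto simp: glauber_matrix_def)
  also have "\<dots> = (\<Sum>\<tau>\<in>configs n. glauber n J (nth_config n k) \<tau> * f \<tau>)"
    by (rule sum.reindex_bij_betw[OF bij_betw_nth_config])
  finally show ?thesis .
qed

text \<open>Path coupling bounds every root of \<open>q\<close> by
  \<open>\<mu> = 1 - (1 - l) / n\<close>, and the linear eigenfunction shows that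
  \<open>\<mu>\<close> is a root. As \<open>\<mu> < 1\<close>, it is the second entry of the
  spectrum, and \<open>n * (1 - \<mu>) = 1 - l\<close>.\<close>

lemma tau_star_perron_pair:
  assumes n: "n \<ge> 2" and J: "\<And>i. i \<in> {1..n} \<Longrightarrow> J i > 0"
    and x: "perron_pair n (\<lambda>i. sinh (2 * J i)) x l"
  shows "tau_star n J = l / (1 - l)"
proof -
  let ?s = "\<lambda>i. sinh (2 * J i)" and ?A = "glauber_matrix n J" and ?L = "heat_bath_avg n (\<lambda>i. sinh (2 * J i))"
  have s: "?s i > 0" if "i \<in> {1..n}" for i using J[OF that] by simp
  have l: "0 < l" "l < 1" using perron_pair_range[OF _ s x] n by auto
  define m where "m = (2::nat) ^ n - 1"
  have N: "2 ^ n = Suc m" by (simp add: m_def)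
  have A: "?A \<in> carrier_mat (Suc m) (Suc m)" using glauber_matrix_carrier[of n J] by (simp add: N)
  have conf: "nth_config n k \<in> configs n" if "k < Suc m" for k
    using bij_betwE[OF bij_betw_nth_config[of n]] that by (simp add: N)
  have apply_A: "(\<Sum>j<Suc m. ?A $$ (k, j) * f (nth_config n j)) = ?L f (nth_config n k)"
    if "k < Suc m" for k f
    using sum_glauber_matrix[of k n J f] sum_glauber_heat_bath[OF n conf[OF that], of J f] that
    by (simp only: N)
  have rows: "(\<Sum>j<Suc m. ?A $$ (k, j)) = 1" if "k < Suc m" for k
  proof -
    have "?L (\<lambda>_. 1) (nth_config n k) = 1"
      using n by (simp add: heat_bath_avg_def heat_bath_def add_divide_distrib[symmetric])
    then show ?thesis using apply_A[OF that, of "\<lambda>_. 1"] by (simp del: sum.lessThan_Suc)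
  qed
  define \<mu> where "\<mu> = 1 - (1 - l) / real n"
  have \<mu>: "\<mu> < 1" using l n by (simp add: \<mu>_def)
  obtain q where q: "q \<noteq> 0" "char_poly ?A = [:- 1, 1:] * q" and
    qroot: "\<forall>\<nu>. poly q \<nu> = 0 \<longrightarrow> (\<exists>g c. (\<forall>i<Suc m. (\<Sum>j<Suc m. ?A $$ (i, j) * g j) = \<nu> * g i + c)
       \<and> (\<exists>i<Suc m. g i \<noteq> g 0))"
    using char_poly_row_sums_one[OF A] rows by blast
  have le: "\<nu> \<le> \<mu>" if root: "poly q \<nu> = 0" for \<nu>
  proof -
    obtain g c i where g: "\<And>i. i < Suc m \<Longrightarrow> (\<Sum>j<Suc m. ?A $$ (i, j) * g j) = \<nu> * g i + c"
      and i: "i < Suc m" "g i \<noteq> g 0"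
      using qroot[rule_format, OF root] by blast
    define f where "f \<sigma> = g (the_inv_into {..<2 ^ n} (nth_config n) \<sigma>)" for \<sigma>
    have f: "f (nth_config n k) = g k" if "k < Suc m" for k
      unfolding f_def using bij_betw_nth_config[of n] that
      by (subst the_inv_into_f_f) (auto simp: bij_betw_def N)
    show ?thesis
      unfolding \<mu>_def
    proof (rule eigenvalue_modulo_constants_le[OF n s x])
      fix \<sigma> assume "\<sigma> \<in> configs n"
      then obtain k where k: "k < Suc m" "\<sigma> = nth_config n k"
        using bij_betw_imp_surj_on[OF bij_betw_nth_config[of n]] by (auto simp: N)
      have "(\<Sum>j<Suc m. ?A $$ (k, j) * f (nth_config n j)) = (\<Sum>j<Suc m. ?A $$ (k, j) * g j)"
        by (rule sum.cong) (auto simp: f)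
      then show "?L f \<sigma> = \<nu> * f \<sigma> + c"
        using apply_A[OF k(1), of f] g[OF k(1)] f[OF k(1)] k(2) by simp
    next
      show "nth_config n i \<in> configs n" "nth_config n 0 \<in> configs n" using conf i by auto
      show "f (nth_config n i) \<noteq> f (nth_config n 0)" using f i by auto
    qed
  qed
  have \<mu>_root: "poly q \<mu> = 0"
  proof -
    define f where "f = (\<lambda>\<sigma> :: nat \<Rightarrow> real. \<Sum>i=1..n. cyc_deg n ?s i * x i * \<sigma> i)"
    define v where "v = vec (Suc m) (\<lambda>k. f (nth_config n k))"
    have "?A *\<^sub>v v = \<mu> \<cdot>\<^sub>v v"
    proof (rule eq_vecI)
      fix k assume "k < dim_vec (\<mu> \<cdot>\<^sub>v v)"
      then have k: "k < Suc m" by (simp add: v_def)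
      have "(?A *\<^sub>v v) $ k = (\<Sum>j<Suc m. ?A $$ (k, j) * f (nth_config n j))"
        using A k by (simp add: v_def scalar_prod_def atLeast0LessThan)
      also have "\<dots> = \<mu> * f (nth_config n k)"
        unfolding apply_A[OF k] using heat_bath_avg_linear[OF n s x conf[OF k]]
        by (simp add: f_def \<mu>_def)
      finally show "(?A *\<^sub>v v) $ k = (\<mu> \<cdot>\<^sub>v v) $ k" using k by (simp add: v_def)
    qed (use A in \<open>simp add: v_def\<close>)
    moreover have "v \<noteq> 0\<^sub>v (Suc m)"
    proof -
      \<comment> \<open>Index 0 encodes the all-minus configuration, where the linear function is
        strictly negative.\<close>
      have "nth_config n 0 i = - 1" if "i \<in> {1..n}" for i using that by (simp add: nth_config_def)
      then have "f (nth_config n 0) = - (\<Sum>i=1..n. cyc_deg n ?s i * x i)"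
        unfolding f_def sum_negf[symmetric] by (intro sum.cong) auto
      moreover have "(\<Sum>i=1..n. cyc_deg n ?s i * x i) > 0"
      proof (rule sum_pos)
        fix i assume "i \<in> {1..n}"
        then show "cyc_deg n ?s i * x i > 0"
          using x cyc_deg_ge[of n ?s i] by (intro mult_pos_pos) (auto simp: perron_pair_def)
      qed (use n in auto)
      ultimately have "v $ 0 \<noteq> 0" by (simp add: v_def)
      then show ?thesis by auto
    qed
    moreover have "v \<in> carrier_vec (Suc m)" by (simp add: v_def)
    ultimately have "eigenvector ?A v \<mu>" using A by (auto simp: eigenvector_def)
    then have "eigenvalue ?A \<mu>" by (auto simp: eigenvalue_def)
    then have "poly (char_poly ?A) \<mu> = 0" using eigenvalue_root_char_poly[OF A] by simp
    \<comment> \<open>As \<open>\<mu> < 1\<close>, the factor \<open>[:- 1, 1:]\<close> does not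
      vanish at \<open>\<mu>\<close>, so the root belongs to \<open>q\<close>.\<close>
    then show ?thesis using q(2) \<mu> by simp
  qed
  have "proots (char_poly ?A) = {#1#} + proots q"
    unfolding q(2) using q(1) by (subst proots_mult) auto
  moreover have "\<mu> \<in># proots q" using \<mu>_root q(1) by simp
  then obtain R where R: "proots q = {#\<mu>#} + R" by (metis multi_member_split add_mset_add_single add.commute)
  ultimately have split: "proots (char_poly ?A) = {#1, \<mu>#} + R" by simp
  have "c \<le> \<mu>" if "c \<in># R" for c
  proof -
    have "c \<in># proots q" unfolding R using that by simp
    then show ?thesis using le q(1) by simp
  qed
  then have "mu n J 2 = \<mu>"
    using sorted_list_of_multiset_second_largest[OF split] \<mu> by (simp add: mu_def eigenvalues_desc_def)
  then have "relaxation_time n J = 1 / (1 - l)"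
    using n by (simp add: relaxation_time_def \<mu>_def)
  then show ?thesis using l by (simp add: tau_star_def field_simps)
qed

theorem proposition10:
  fixes n :: nat and J :: "nat \<Rightarrow> real" and t :: real
  assumes "n \<ge> 3"
    and "\<And>i. i \<in> {1..n} \<Longrightarrow> J i > 0"
    and "t \<ge> 0"
  shows "tau_star n (\<lambda>i. 1 / 2 * arsinh (exp (2 * t) * sinh (2 * J i)))
           \<ge> exp (2 * t) * tau_star n J"
proof -
  let ?s = "\<lambda>i. sinh (2 * J i)" and ?k = "exp (2 * t)"
  let ?J' = "\<lambda>i. 1 / 2 * arsinh (?k * ?s i)"
  have s: "?s i > 0" if "i \<in> {1..n}" for i using assms(2)[OF that] by simp
  have J': "?J' i > 0" if "i \<in> {1..n}" for i using s[OF that] by simp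
  \<comment> \<open>\<open>arsinh\<close> is undone, so the new couplings amount to multiplying
    \<open>s\<close> by \<open>exp (2 * t)\<close>, which is at least 1.\<close>
  have s': "(\<lambda>i. sinh (2 * ?J' i)) = (\<lambda>i. ?k * ?s i)" by simp
  obtain x l where x: "perron_pair n ?s x l"
    using perron_pair_exists[of n ?s] s assms(1) by auto
  obtain x' l' where x': "perron_pair n (\<lambda>i. ?k * ?s i) x' l'"
    using perron_pair_exists[of n "\<lambda>i. ?k * ?s i"] s assms(1) by auto
  have "?k * (l / (1 - l)) \<le> l' / (1 - l')"
    by (rule perron_pair_scale[OF _ s _ x x']) (use assms in auto)
  moreover have "tau_star n J = l / (1 - l)"
    by (rule tau_star_perron_pair[OF _ assms(2) x]) (use assms(1) in auto)
  moreover have "tau_star n ?J' = l' / (1 - l')"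
  proof (rule tau_star_perron_pair[OF _ J'])
    show "perron_pair n (\<lambda>i. sinh (2 * ?J' i)) x' l'" unfolding s' by (rule x')
  qed (use assms(1) in auto)
  ultimately show ?thesis by simp
qed

end
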